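(* Consider the online allocation problem and Algorithm 1 described in the context, with step-size $\eta\ge0$ and initial dual solution $\mu_1\in\mathbb{R}^m_+$. Suppose Assumption 1 and Assumption 2 hold and the request sequence $\vec\gamma$ is drawn from a joint distribution $\mathcal P\in\Delta(\mathcal S^T)$. For $k\in[T]$ and $\bar{\mathcal P}\in\Delta(\mathcal S)$ define $$\mathrm{TV}_k(\mathcal P,\bar{\mathcal P})=\sup_{\vec\gamma\in\mathcal S^T}\ \sup_{t=1,\dots,T-k}\big\|\mathcal P_{t+k}(\gamma_{1:t-1})-\bar{\mathcal P}\big\|_{\mathrm{TV}},$$ where $\mathcal P_{t}(\gamma_{1:s})$ is the conditional distribution of $\gamma_t$ given $\gamma_{1:s}=(\gamma_1,\dots,\gamma_s)$, and let $\mathcal C^{\mathrm E}(\delta,k)=\{\mathcal P\in\Delta(\mathcal S^T):\mathrm{TV}_k(\mathcal P,\bar{\mathcal P})\le\delta\text{ for some }\bar{\mathcal P}\in\Delta(\mathcal S)\}$. Then for every $T\ge1$, $\delta\ge0$ and $k\ge0$, $$\sup_{\mathcal P\in\mathcal C^{\mathrm E}(\delta,k)}\mathbb{E}_{\vec\gamma\sim\mathcal P}\big[\mathrm{OPT}(\vec\gamma)-R(A\mid\vec\gamma)\big]\le C_1+C_2\eta T+\frac{C_3}{\eta}+C_4\eta Tk+2\bar fT\delta+2\bar fk,$$ with $C_1=\bar f\bar b/\underline\rho$, $C_2=(\bar b+\bar\rho)^2/(2\sigma)$, $C_3=\max\{V_h(\mu,\mu_1):\mu\in\{0,(\bar f/\rho_1)e_1,\ldots,(\bar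 f/\rho_m)e_m\}\}$ and $C_4=\frac{\sqrt2\,\bar b}{\sigma}(\bar b+\bar\rho)$.
   Context: Online allocation problem: horizon $T\ge1$, $m\ge1$ resources. A request is $\gamma=(f,b,\mathcal X)$ with $\mathcal X\subset\mathbb{R}^d_+$ compact, $0\in\mathcal X$, $f:\mathcal X\to\mathbb{R}_+$, $b:\mathcal X\to\mathbb{R}^m_+$, $b(0)=0$; $\mathcal S$ is the set of possible requests; $\|\cdot\|_{\mathrm{TV}}$ total variation distance; $e_j$ the $j$-th unit vector. Resource vector $\rho$, all $\rho_j>0$, total resources $T\rho$; $\underline\rho=\min_j\rho_j$, $\bar\rho=\max_j\rho_j$. $\mathrm{OPT}(\vec\gamma)=\max\{\sum_t f_t(x_t):x_t\in\mathcal X_t,\sum_t b_t(x_t)\le T\rho\}$; $R(A\mid\vec\gamma)=\sum_t f_t(x_t)$. Assumption 1: there exist $\bar f,\bar b\ge0$ such that for every $(f,b,\mathcal X)\in\mathcal S$: $0\in\mathcal X$; $0\le f\le\bar f$; $b\ge0$, $\|b(x)\|_\infty\le\bar b$; $\max_{x\in\mathcal X}\{f(x)-\mu^\top b(x)\}$ attained for all $\mu\in\mathbb{R}^m_+$. Assumption 2: $h$ differentiable (or essentially smooth) on $\mathbb{R}^m_+$ and $\sigma$-strongly convex w.r.t. $\|\cdot\|_1$ there. $V_h(x,y)=h(x)-h(y)-\nabla h(y)^\top(x-y)$. Algorithm 1: $B_1=T\rho$; for each $t$: $\tilde x_t\in\arg\max_{x\in\mathcal X_t}\{f_t(x)-\mu_t^\top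 b_t(x)\}$; $x_t=\tilde x_t$ if $b_t(\tilde x_t)\le B_t$, else $0$; $B_{t+1}=B_t-b_t(x_t)$; $\tilde g_t=\rho-b_t(\tilde x_t)$; $\mu_{t+1}=\arg\min_{\mu\in\mathbb{R}^m_+}\{\tilde g_t^\top\mu+\frac1\eta V_h(\mu,\mu_t)\}$. *)

theory Defs
  imports "HOL-Probability.Probability"
begin

section \<open>Requests and the offline optimum\<close>

text \<open>The orthant of nonnegative vectors is the set \<open>{0..}\<close> for the componentwise order on
  \<open>real ^ 'n\<close>. The values of \<open>reward\<close> and \<open>consumption\<close> outside \<open>feasible\<close> are never used.\<close>

datatype ('d::finite, 'm::finite) request = Request
  (reward: "real ^ 'd \<Rightarrow> real")
  (consumption: "real ^ 'd \<Rightarrow> real ^ 'm")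
  (feasible: "(real ^ 'd) set")

definition is_request :: "('d::finite, 'm::finite) request \<Rightarrow> bool" where
  "is_request g \<longleftrightarrow>
     compact (feasible g) \<and> feasible g \<subseteq> {0..} \<and> 0 \<in> feasible g \<and>
     (\<forall>x\<in>feasible g. 0 \<le> reward g x) \<and>
     (\<forall>x\<in>feasible g. 0 \<le> consumption g x) \<and>
     consumption g 0 = 0"

definition bounded_requests ::
  "('d::finite, 'm::finite) request set \<Rightarrow> real \<Rightarrow> real \<Rightarrow> bool" where
  "bounded_requests S fbar bbar \<longleftrightarrow>
     0 \<le> fbar \<and> 0 \<le> bbar \<and>
     (\<forall>g\<in>S. 0 \<in> feasible g \<and>
        (\<forall>x\<in>feasible g. 0 \<le> reward g x \<and> reward g x \<le> fbar) \<and>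
        (\<forall>x\<in>feasible g. 0 \<le> consumption g x \<and> infnorm (consumption g x) \<le> bbar) \<and>
        (\<forall>\<mu>\<ge>0. \<exists>x. is_arg_max (\<lambda>x. reward g x - \<mu> \<bullet> consumption g x)
                        (\<lambda>x. x \<in> feasible g) x))"

definition opt_reward :: "('d::finite, 'm::finite) request \<Rightarrow> real ^ 'm \<Rightarrow> real" where
  "opt_reward g \<mu> = (SUP x\<in>feasible g. reward g x - \<mu> \<bullet> consumption g x)"

text \<open>A supremum, since rewards and consumptions need not be continuous and a maximiser of the
  offline problem need not exist.\<close>

definition OPT :: "nat \<Rightarrow> real ^ 'm \<Rightarrow> (nat \<Rightarrow> ('d::finite, 'm::finite) request) \<Rightarrow> real" where
  "OPT T \<rho> \<gamma> =
     (SUP x\<in>{x. (\<forall>t\<in>{1..T}. x t \<in> feasible (\<gamma> t)) \<and>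
                (\<Sum>t=1..T. consumption (\<gamma> t) (x t)) \<le> real T *\<^sub>R \<rho>}.
        \<Sum>t=1..T. reward (\<gamma> t) (x t))"

section \<open>Reference function and Bregman divergence\<close>

definition l1_norm :: "real ^ 'm::finite \<Rightarrow> real" where
  "l1_norm x = (\<Sum>i\<in>UNIV. \<bar>x $ i\<bar>)"

definition strongly_convex_l1_on ::
  "(real ^ 'm::finite) set \<Rightarrow> real \<Rightarrow> (real ^ 'm \<Rightarrow> real) \<Rightarrow> bool" where
  "strongly_convex_l1_on C \<sigma> h \<longleftrightarrow>
     (\<forall>x\<in>C. \<forall>y\<in>C. \<forall>u\<in>{0..1}.
        h (u *\<^sub>R x + (1 - u) *\<^sub>R y)
          \<le> u * h x + (1 - u) * h y - \<sigma> / 2 * u * (1 - u) * (l1_norm (x - y))\<^sup>2)"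

text \<open>Essential smoothness in the sense of Rockafellar, for the extended-valued convex function
  with effective domain \<open>D\<close> that is given by \<open>h\<close> on \<open>D\<close> and by \<open>\<infinity>\<close> elsewhere. The operator
  norm of the derivative is the Euclidean norm of the gradient.\<close>

definition essentially_smooth_on ::
  "(real ^ 'm::finite) set \<Rightarrow> (real ^ 'm \<Rightarrow> real) \<Rightarrow> bool" where
  "essentially_smooth_on D h \<longleftrightarrow>
     convex D \<and> convex_on D h \<and> interior D \<noteq> {} \<and>
     (\<forall>x\<in>interior D. h differentiable (at x)) \<and>
     (\<forall>x\<in>frontier D.
        filterlim (\<lambda>y. onorm (frechet_derivative h (at y))) at_top (at x within interior D))"

definition reference_function :: "real \<Rightarrow> (real ^ 'm::finite \<Rightarrow> real) \<Rightarrow> bool" where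
  "reference_function \<sigma> h \<longleftrightarrow>
     0 < \<sigma> \<and> strongly_convex_l1_on {0..} \<sigma> h \<and>
     (h differentiable_on {0..} \<or> (\<exists>D. {0..} \<subseteq> D \<and> essentially_smooth_on D h))"

text \<open>The derivative is taken within the orthant, where it is unique (also at boundary points)
  and agrees with the full derivative whenever the latter exists.\<close>

definition bregman :: "(real ^ 'm::finite \<Rightarrow> real) \<Rightarrow> real ^ 'm \<Rightarrow> real ^ 'm \<Rightarrow> real" where
  "bregman h x y = h x - h y - frechet_derivative h (at y within {0..}) (x - y)"

section \<open>Dual mirror descent\<close>

text \<open>\<open>xt\<close>, \<open>x\<close>, \<open>B\<close>, \<open>mu\<close> are the tentative decisions, the decisions taken, the remaining
  resources and the dual iterates along the request sequence \<open>\<gamma>\<close>. The relation leaves the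
  tie-breaking among maximisers open.\<close>

definition dual_mirror_descent ::
  "nat \<Rightarrow> real ^ 'm \<Rightarrow> (real ^ 'm \<Rightarrow> real) \<Rightarrow> real \<Rightarrow> real ^ 'm \<Rightarrow>
   (nat \<Rightarrow> ('d::finite, 'm::finite) request) \<Rightarrow> (nat \<Rightarrow> real ^ 'd) \<Rightarrow>
   (nat \<Rightarrow> real ^ 'd) \<Rightarrow> (nat \<Rightarrow> real ^ 'm) \<Rightarrow> (nat \<Rightarrow> real ^ 'm) \<Rightarrow> bool" where
  "dual_mirror_descent T \<rho> h \<eta> \<mu>1 \<gamma> xt x B mu \<longleftrightarrow>
     B 1 = real T *\<^sub>R \<rho> \<and> mu 1 = \<mu>1 \<and>
     (\<forall>t\<in>{1..T}.
        is_arg_max (\<lambda>z. reward (\<gamma> t) z - mu t \<bullet> consumption (\<gamma> t) z)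
                   (\<lambda>z. z \<in> feasible (\<gamma> t)) (xt t) \<and>
        x t = (if consumption (\<gamma> t) (xt t) \<le> B t then xt t else 0) \<and>
        B (t + 1) = B t - consumption (\<gamma> t) (x t) \<and>
        is_arg_min (\<lambda>\<nu>. (\<rho> - consumption (\<gamma> t) (xt t)) \<bullet> \<nu> + 1 / \<eta> * bregman h \<nu> (mu t))
                   (\<lambda>\<nu>. 0 \<le> \<nu>) (mu (t + 1)))"

section \<open>Request processes\<close>

text \<open>A measurable space of requests is a measure \<open>M\<close> of which only \<open>space M\<close> and \<open>sets M\<close>
  matter. A history \<open>\<gamma>\<^sub>1, \<dots>, \<gamma>\<^sub>s\<close> is a point of the product over \<open>{1..s}\<close>.\<close>

abbreviation hist :: "nat \<Rightarrow> 'a measure \<Rightarrow> (nat \<Rightarrow> 'a) measure" where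
  "hist s M \<equiv> Pi\<^sub>M {1..s} (\<lambda>_. M)"

text \<open>The normalisation with values in \<open>[0, 1]\<close>, i.e. half the \<open>L\<^sup>1\<close> distance.\<close>

definition tv_dist :: "'a measure \<Rightarrow> 'a measure \<Rightarrow> 'a measure \<Rightarrow> ennreal" where
  "tv_dist M P Q = (SUP A\<in>sets M. ennreal \<bar>measure P A - measure Q A\<bar>)"

text \<open>\<open>K\<close> is a (regular) conditional distribution of \<open>\<gamma>\<^sub>t\<close> given \<open>\<gamma>\<^sub>1, \<dots>, \<gamma>\<^sub>s\<close> under \<open>P\<close>.\<close>

definition cond_distribution ::
  "'a measure \<Rightarrow> (nat \<Rightarrow> 'a) measure \<Rightarrow> nat \<Rightarrow> nat \<Rightarrow> ((nat \<Rightarrow> 'a) \<Rightarrow> 'a measure) \<Rightarrow> bool" where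
  "cond_distribution M P t s K \<longleftrightarrow>
     K \<in> hist s M \<rightarrow>\<^sub>M prob_algebra M \<and>
     (\<forall>A\<in>sets (hist s M). \<forall>C\<in>sets M.
        emeasure P {\<gamma> \<in> space P. restrict \<gamma> {1..s} \<in> A \<and> \<gamma> t \<in> C} =
        (\<integral>\<^sup>+ \<gamma>. indicator A (restrict \<gamma> {1..s}) * emeasure (K (restrict \<gamma> {1..s})) C \<partial>P))"

text \<open>\<open>K t s\<close> is the conditional distribution of \<open>\<gamma>\<^sub>t\<close> given \<open>\<gamma>\<^sub>1, \<dots>, \<gamma>\<^sub>s\<close>. The supremum over
  request sequences is a genuine one, so it depends on the version that has been chosen; for
  \<open>k \<ge> T\<close> it is the empty supremum \<open>0\<close>.\<close>

definition TV_lag ::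
  "'a measure \<Rightarrow> nat \<Rightarrow> nat \<Rightarrow> (nat \<Rightarrow> nat \<Rightarrow> (nat \<Rightarrow> 'a) \<Rightarrow> 'a measure) \<Rightarrow> 'a measure \<Rightarrow> ennreal" where
  "TV_lag M T k K Q =
     (SUP \<gamma>\<in>space (hist T M). SUP t\<in>{1..T - k}.
        tv_dist M (K (t + k) (t - 1) (restrict \<gamma> {1..t - 1})) Q)"

definition ergodic_class ::
  "'a measure \<Rightarrow> nat \<Rightarrow> real \<Rightarrow> nat \<Rightarrow> (nat \<Rightarrow> 'a) measure set" where
  "ergodic_class M T \<delta> k =
     {P \<in> space (prob_algebra (hist T M)).
        \<exists>K. (\<forall>t\<in>{1..T - k}. cond_distribution M P (t + k) (t - 1) (K (t + k) (t - 1))) \<and>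
            (\<exists>Q\<in>space (prob_algebra M). TV_lag M T k K Q \<le> ennreal \<delta>)}"

text \<open>Measurability needed for the expectations to be meaningful; all conditions hold
  automatically if the set of requests is countable and every subset of it is measurable.
  The rule \<open>xt t\<close> maps the history \<open>\<gamma>\<^sub>1, \<dots>, \<gamma>\<^sub>t\<close> to the tentative decision in period \<open>t\<close>.\<close>

definition measurable_requests ::
  "('d::finite, 'm::finite) request measure \<Rightarrow> nat \<Rightarrow> real ^ 'm \<Rightarrow> bool" where
  "measurable_requests M T \<rho> \<longleftrightarrow>
     (\<forall>\<mu>\<ge>0. (\<lambda>g. opt_reward g \<mu>) \<in> borel_measurable M) \<and>
     (\<lambda>g. reward g 0) \<in> borel_measurable M \<and>
     OPT T \<rho> \<in> borel_measurable (hist T M)"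

definition measurable_rule ::
  "('d::finite, 'm::finite) request measure \<Rightarrow> nat \<Rightarrow>
   (nat \<Rightarrow> (nat \<Rightarrow> ('d, 'm) request) \<Rightarrow> real ^ 'd) \<Rightarrow> bool" where
  "measurable_rule M T xt \<longleftrightarrow>
     (\<forall>t\<in>{1..T}.
        (\<lambda>\<gamma>. reward (\<gamma> t) (xt t \<gamma>)) \<in> borel_measurable (hist t M) \<and>
        (\<lambda>\<gamma>. consumption (\<gamma> t) (xt t \<gamma>)) \<in> borel_measurable (hist t M))"

end

(* Stop at the last period before some resource could run out. Up to then the reward is the
   dual function along the iterates minus the inner products of iterates and subgradients;
   the latter are controlled by the mirror descent regret against 0 or a multiple of the unit
   vector of the nearly exhausted resource, which pays for the rewards lost after stopping.
   The request in period t + k is compared with the dual iterate of period t, which depends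
   on the periods before t only. Conditionally on these, the request has nearly the law Pbar,
   so that the expected dual value is at least the minimum of the stationary dual function, up
   to fbar * delta; the drift of the iterates over k periods costs C4. Weak duality with the
   marginal laws of the requests bounds the expected optimum by the same minimum. *)
theory Submission
  imports Defs
begin

section \<open>The mirror step\<close>

text \<open>The stopped sum has a random length, while the comparison with \<open>Pbar\<close> is
  conditional. Subtracting the stationary dual value \<open>c\<close> from each lagged term, and
  setting the term to zero after stopping, gives a sum over the fixed range \<open>1..T - k\<close>.
  Stopping is decided by the same past as the dual iterate, so each term is treated by conditioning
  alone, without a martingale argument. The total variation error is paid once for the iterates and
  once for the marginal laws in the bound on the optimum, hence
  \<open>2 * fbar * T * \<delta>\<close>; likewise \<open>2 * fbar * k\<close> consists of the
  \<open>k\<close> periods lost by the lag and of the first \<open>k\<close> requests, about which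
  the lagged conditional laws say nothing. The conditioning presupposes that the iterates are
  measurable functions of the past, although they are given only as minimisers: strong convexity
  supplies both uniqueness and the quadratic growth from which measurability follows.\<close>

lemma convex_orthant: "convex {0 :: real ^ 'n ..}"
  by (auto simp: convex_alt less_eq_vec_def)

text \<open>At boundary points of \<open>S\<close> only directions into \<open>S\<close> are
  available. The segment from \<open>y\<close> to \<open>x\<close> stays in \<open>S\<close> by
  convexity, and the chain rule leaves a function of one variable at the left end of
  \<open>[0, 1]\<close>.\<close>

lemma has_derivative_quotient_at_right:
  fixes h :: "'a::real_normed_vector \<Rightarrow> real"
  assumes "(h has_derivative D) (at y within S)" "convex S" "x \<in> S" "y \<in> S"
  shows "((\<lambda>u. (h (y + u *\<^sub>R (x - y)) - h y) / u) \<longlongrightarrow> D (x - y)) (at_right 0)"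
proof -
  let ?p = "\<lambda>u. y + u *\<^sub>R (x - y)"
  have p: "(?p has_derivative (\<lambda>u. u *\<^sub>R (x - y))) (at 0 within {0..1})"
    by (auto intro!: derivative_eq_intros)
  have sub: "?p ` {0..1} \<subseteq> S"
  proof (intro image_subsetI)
    fix u :: real assume "u \<in> {0..1}"
    then have "(1 - u) *\<^sub>R y + u *\<^sub>R x \<in> S"
      using assms by (auto simp: convex_alt)
    then show "?p u \<in> S" by (simp add: algebra_simps)
  qed
  have "(h has_derivative D) (at (?p 0) within ?p ` {0..1})"
    using assms(1) sub by (auto intro: has_derivative_subset)
  from has_derivative_in_compose[OF p this]
  have "((\<lambda>u. h (?p u)) has_derivative (\<lambda>u. D (u *\<^sub>R (x - y)))) (at 0 within {0..1})" .
  moreover have "(\<lambda>u. D (u *\<^sub>R (x - y))) = (*) (D (x - y))"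
    using has_derivative_linear[OF assms(1)] by (auto simp: linear_scale fun_eq_iff)
  ultimately have "((\<lambda>u. h (?p u)) has_field_derivative D (x - y)) (at 0 within {0..1})"
    by (simp add: has_field_derivative_def)
  then show ?thesis
    by (simp add: has_field_derivative_iff at_within_Icc_at_right)
qed

text \<open>Divide by \<open>u\<close> and let \<open>u\<close> tend to \<open>0\<close>. The case
  \<open>\<kappa> = 0\<close> is convexity; a quadratic \<open>\<kappa>\<close> is strong
  convexity.\<close>

lemma has_derivative_le_of_segment:
  fixes h :: "'a::real_normed_vector \<Rightarrow> real"
  assumes D: "(h has_derivative D) (at y within S)" "convex S" "x \<in> S" "y \<in> S"
    and le: "\<And>u. 0 < u \<Longrightarrow> u < 1 \<Longrightarrow>
      h (u *\<^sub>R x + (1 - u) *\<^sub>R y) \<le> u * h x + (1 - u) * h y - \<kappa> * u * (1 - u)"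
  shows "D (x - y) \<le> h x - h y - \<kappa>"
proof -
  have "((\<lambda>u::real. h x - h y - \<kappa> * (1 - u)) \<longlongrightarrow> h x - h y - \<kappa> * (1 - 0)) (at_right 0)"
    by (intro tendsto_intros)
  moreover have "\<forall>\<^sub>F u in at_right 0.
      (h (y + u *\<^sub>R (x - y)) - h y) / u \<le> h x - h y - \<kappa> * (1 - u)"
    unfolding eventually_at_right_field
  proof (intro exI[of _ 1] conjI allI impI)
    fix u :: real assume u: "0 < u" "u < 1"
    have eq: "u *\<^sub>R x + (1 - u) *\<^sub>R y = y + u *\<^sub>R (x - y)" by (simp add: algebra_simps)
    have "h (y + u *\<^sub>R (x - y)) - h y \<le> u * (h x - h y - \<kappa> * (1 - u))"
      using le[OF u] unfolding eq by (simp add: algebra_simps)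
    then show "(h (y + u *\<^sub>R (x - y)) - h y) / u \<le> h x - h y - \<kappa> * (1 - u)"
      using u by (simp add: field_simps)
  qed simp
  ultimately show ?thesis
    using tendsto_le[OF _ _ has_derivative_quotient_at_right[OF D]] by fastforce
qed

lemma convex_on_has_derivative_ge:
  fixes h :: "'a::real_normed_vector \<Rightarrow> real"
  assumes "convex_on S h" "(h has_derivative D) (at y within S)" "x \<in> S" "y \<in> S"
  shows "h y + D (x - y) \<le> h x"
proof -
  have "D (x - y) \<le> h x - h y - 0"
  proof (rule has_derivative_le_of_segment[OF assms(2) _ assms(3,4)])
    show "convex S" using assms(1) by (rule convex_on_imp_convex)
    fix u :: real assume "0 < u" "u < 1"
    then show "h (u *\<^sub>R x + (1 - u) *\<^sub>R y) \<le> u * h x + (1 - u) * h y - 0 * u * (1 - u)"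
      using convex_onD[OF assms(1), of "1-u" x y] assms by (simp add: algebra_simps)
  qed
  then show ?thesis by simp
qed

text \<open>First-order optimality over a convex set: every difference quotient at a minimiser is
  nonnegative, and so is its one-sided limit.\<close>

lemma has_derivative_ge_of_minimum:
  fixes h :: "'a::real_normed_vector \<Rightarrow> real"
  assumes D: "(h has_derivative D) (at y within S)" "convex S" "x \<in> S" "y \<in> S"
    and min: "\<And>z. z \<in> S \<Longrightarrow> h y \<le> h z"
  shows "0 \<le> D (x - y)"
proof (rule tendsto_lowerbound[OF has_derivative_quotient_at_right[OF D]])
  show "\<forall>\<^sub>F u in at_right 0. 0 \<le> (h (y + u *\<^sub>R (x - y)) - h y) / u"
    unfolding eventually_at_right_field
  proof (intro exI[of _ 1] conjI allI impI)
    fix u :: real assume u: "0 < u" "u < 1"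
    have "(1 - u) *\<^sub>R y + u *\<^sub>R x \<in> S"
      using assms u by (auto simp: convex_alt)
    then have "y + u *\<^sub>R (x - y) \<in> S" by (simp add: algebra_simps)
    from min[OF this] show "0 \<le> (h (y + u *\<^sub>R (x - y)) - h y) / u" using u by simp
  qed simp
qed simp

section \<open>The \<open>l1\<close> norm and the quadratic lower bound on the divergence\<close>

lemma l1_norm_nonneg: "0 \<le> l1_norm x"
  by (simp add: l1_norm_def sum_nonneg)

lemma l1_norm_minus_commute: "l1_norm (x - y) = l1_norm (y - x)"
  by (simp add: l1_norm_def abs_minus_commute)

lemma l1_norm_triangle: "l1_norm (x - z) \<le> l1_norm (x - y) + l1_norm (y - z)"
  unfolding l1_norm_def sum.distrib[symmetric] by (rule sum_mono) auto

lemma norm_le_l1_norm: "norm x \<le> l1_norm x"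
  unfolding l1_norm_def by (rule norm_le_l1_cart)

text \<open>Hoelder's inequality for the pair sup norm and \<open>l1\<close> norm; subgradients are
  bounded componentwise, which is why strong convexity is measured in \<open>l1\<close>.\<close>

lemma inner_le_l1_norm:
  fixes g x :: "real ^ 'n"
  assumes "\<And>j. \<bar>g $ j\<bar> \<le> G"
  shows "g \<bullet> x \<le> G * l1_norm x"
  unfolding inner_vec_def l1_norm_def sum_distrib_left
proof (rule sum_mono)
  fix i
  have "g $ i * x $ i \<le> \<bar>g $ i\<bar> * \<bar>x $ i\<bar>" by (metis abs_ge_self abs_mult)
  also have "\<dots> \<le> G * \<bar>x $ i\<bar>" using assms by (intro mult_right_mono) auto
  finally show "g $ i \<bullet> x $ i \<le> G * \<bar>x $ i\<bar>" by simp
qed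

lemma bregman_ge:
  assumes "strongly_convex_l1_on {0..} \<sigma> h" "h differentiable (at y within {0..})" "0 \<le> x" "0 \<le> y"
  shows "\<sigma> / 2 * (l1_norm (x - y))\<^sup>2 \<le> bregman h x y"
proof -
  have "frechet_derivative h (at y within {0..}) (x - y) \<le> h x - h y - \<sigma> / 2 * (l1_norm (x - y))\<^sup>2"
  proof (rule has_derivative_le_of_segment[OF _ convex_orthant])
    fix u :: real assume "0 < u" "u < 1"
    then show "h (u *\<^sub>R x + (1 - u) *\<^sub>R y)
        \<le> u * h x + (1 - u) * h y - (\<sigma> / 2 * (l1_norm (x - y))\<^sup>2) * u * (1 - u)"
      using assms(1)[unfolded strongly_convex_l1_on_def, rule_format, of x y u] assms(3,4)
      by (simp add: mult_ac)
  qed (use assms frechet_derivative_works in auto)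
  then show ?thesis by (simp add: bregman_def)
qed

text \<open>If \<open>z\<close> were on the frontier, gradients of \<open>h\<close> would have to
  blow up along the segment from an interior point \<open>y\<close> to \<open>z\<close>. Minimality
  of \<open>z\<close> bounds the slope towards \<open>y\<close> from below, and an upper bound on
  \<open>h\<close> near \<open>y\<close> then bounds, through the tangent inequality, the derivative
  in all directions.\<close>

lemma essentially_smooth_minimizer_interior:
  fixes h :: "real ^ 'm::finite \<Rightarrow> real"
  assumes ess: "essentially_smooth_on D h" and D: "{0..} \<subseteq> D" and L: "linear L"
    and z: "0 \<le> z" and min: "\<And>\<nu>. 0 \<le> \<nu> \<Longrightarrow> L z + h z \<le> L \<nu> + h \<nu>"
  shows "z \<in> interior D"
proof (rule ccontr)
  assume "z \<notin> interior D"
  then have zf: "z \<in> frontier D"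
    using z D closure_subset by (auto simp: frontier_def)
  have cvx: "convex D" and conv: "convex_on D h"
    and diff: "\<And>w. w \<in> interior D \<Longrightarrow> (h has_derivative frechet_derivative h (at w)) (at w)"
    and lim: "filterlim (\<lambda>y. onorm (frechet_derivative h (at y))) at_top (at z within interior D)"
    using ess zf by (auto simp: essentially_smooth_on_def frechet_derivative_works)
  \<comment> \<open>Any point with a ball around it inside the orthant would do; the ball then lies
    in the interior of \<open>D\<close>.\<close>
  define y :: "real ^ 'm" where "y = (\<chi> j. 1)"
  have cball: "cball y (1/2) \<subseteq> {0..}"
  proof
    fix v assume "v \<in> cball y (1/2)"
    then have "norm (v - y) \<le> 1/2" by (simp add: dist_norm norm_minus_commute)
    then have "\<bar>v $ j - 1\<bar> \<le> 1/2" for j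
      using component_le_norm_cart[of "v - y" j] by (simp add: y_def)
    then have "0 \<le> v $ j" for j
      by (smt (verit) field_sum_of_halves)
    then show "v \<in> {0..}" by (simp add: less_eq_vec_def)
  qed
  have "ball y (1/2) \<subseteq> D"
    using cball D ball_subset_cball by (meson order_trans)
  then have "ball y (1/2) \<subseteq> interior D" by (simp add: interior_maximal)
  moreover have "cball y (1/4) \<subseteq> ball y (1/2)" by auto
  ultimately have cball_int: "cball y (1/4) \<subseteq> interior D" by blast
  have yint: "y \<in> interior D" using cball_int by auto
  have cont: "continuous_on (cball y (1/4)) h"
    by (intro continuous_at_imp_continuous_on ballI has_derivative_continuous[OF diff])
      (use cball_int in auto)
  obtain C where C: "\<And>w. w \<in> cball y (1/4) \<Longrightarrow> h w \<le> C"
    using continuous_attains_sup[OF compact_cball _ cont] by fastforce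
  define p where "p = (\<lambda>u. z + u *\<^sub>R (y - z))"
  have p_int: "p u \<in> interior D" if "0 < u" "u < 1" for u
  proof -
    have "z - (- u) *\<^sub>R (y - z) = z - u *\<^sub>R (z - y)" by (simp add: algebra_simps)
    with mem_interior_convex_shrink[OF cvx yint, of z u] show ?thesis
      using that z D by (auto simp: p_def)
  qed
  \<comment> \<open>The factor 4 is the inverse radius of the ball around \<open>y\<close>. One
    \<open>\<bar>L (y - z)\<bar>\<close> pays for the lower bound on \<open>h (p u)\<close>, the
    other for the slope from \<open>p u\<close> towards \<open>y\<close>.\<close>
  define R where "R = 4 * (C - h z + 2 * \<bar>L (y - z)\<bar>)"
  have bound: "onorm (frechet_derivative h (at (p u))) \<le> R" if u: "0 < u" "u < 1" for u
  proof -
    let ?D = "frechet_derivative h (at (p u))"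
    have hd: "(h has_derivative ?D) (at (p u))" using diff p_int u by blast
    have lin: "linear ?D" by (rule has_derivative_linear[OF hd])
    have tangent: "h (p u) + ?D (w - p u) \<le> h w" if "w \<in> D" for w
      using that p_int[OF u] interior_subset
      by (intro convex_on_has_derivative_ge[OF conv has_derivative_at_withinI[OF hd]]) auto
    have "0 \<le> p u"
    proof -
      have "(1 - u) *\<^sub>R z + u *\<^sub>R y \<in> {0..}"
        using convexD_alt[OF convex_orthant, of z y u] z u cball[THEN subsetD, of y] by auto
      then show ?thesis by (simp add: p_def algebra_simps)
    qed
    from min[OF this] have min': "h z \<le> h (p u) + u * L (y - z)"
      by (simp add: p_def linear_add[OF L] linear_scale[OF L])
    have "z - p u = (- u) *\<^sub>R (y - z)" by (simp add: p_def)
    then have "?D (z - p u) = - u * ?D (y - z)" by (simp only: linear_scale[OF lin]) simp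
    \<comment> \<open>The tangent at \<open>p u\<close>, evaluated at \<open>z\<close>, lies below
      \<open>h z\<close>, which minimality bounds in terms of \<open>h (p u)\<close>; the values of
      \<open>h\<close> cancel.\<close>
    with tangent[of z] min' z D have "0 \<le> u * (?D (y - z) + L (y - z))"
      by (auto simp: algebra_simps)
    with u have D_ge: "- L (y - z) \<le> ?D (y - z)" by (simp add: zero_le_mult_iff)
    have "?D (y - p u) = ?D ((1 - u) *\<^sub>R (y - z))" by (simp add: p_def algebra_simps)
    also have "\<dots> = (1 - u) * ?D (y - z)" by (simp add: linear_scale[OF lin])
    also have "\<dots> \<ge> (1 - u) * - \<bar>L (y - z)\<bar>" using D_ge u by (intro mult_left_mono) auto
    also have "(1 - u) * - \<bar>L (y - z)\<bar> \<ge> - \<bar>L (y - z)\<bar>" using u by (simp add: algebra_simps)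
    finally have D_y: "- \<bar>L (y - z)\<bar> \<le> ?D (y - p u)" .
    have "u * L (y - z) \<le> u * \<bar>L (y - z)\<bar>" using u by (intro mult_left_mono) auto
    also have "\<dots> \<le> 1 * \<bar>L (y - z)\<bar>" using u by (intro mult_right_mono) auto
    finally have hp: "h z - \<bar>L (y - z)\<bar> \<le> h (p u)" using min' by simp
    have small: "?D v \<le> R / 4" if "norm v \<le> 1/4" for v
    proof -
      have "y + v \<in> cball y (1/4)" using that by (simp add: dist_norm)
      then have "h (p u) + ?D (y + v - p u) \<le> C"
        using C tangent cball_int interior_subset by (meson order_trans subsetD)
      also have "y + v - p u = (y - p u) + v" by simp
      finally have "h (p u) + (?D (y - p u) + ?D v) \<le> C" by (simp add: linear_add[OF lin])
      with hp D_y show ?thesis by (simp add: R_def)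
    qed
    show ?thesis
    proof (rule onorm_le)
      fix v
      show "norm (?D v) \<le> R * norm v"
      proof (cases "v = 0")
        case True
        then show ?thesis using linear_0[OF lin] by simp
      next
        case False
        let ?c = "1 / (4 * norm v)"
        have "?D (?c *\<^sub>R v) \<le> R / 4" "?D ((- ?c) *\<^sub>R v) \<le> R / 4"
          by (rule small, use False in simp)+
        then have "?c * \<bar>?D v\<bar> \<le> R / 4"
          unfolding linear_scale[OF lin] using False by (auto simp: abs_if)
        then show ?thesis using False by (simp add: field_simps)
      qed
    qed
  qed
  have "y \<noteq> z" using yint zf by (auto simp: frontier_def)
  have "filterlim p (at z within interior D) (at_right 0)"
    unfolding filterlim_at
  proof
    show "\<forall>\<^sub>F u in at_right 0. p u \<in> interior D \<and> p u \<noteq> z"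
      unfolding eventually_at_right_field using p_int \<open>y \<noteq> z\<close>
      by (intro exI[of _ 1]) (auto simp: p_def)
    have "(p \<longlongrightarrow> z + 0 *\<^sub>R (y - z)) (at_right 0)" unfolding p_def by (intro tendsto_intros)
    then show "(p \<longlongrightarrow> z) (at_right 0)" by simp
  qed
  from filterlim_compose[OF lim this]
  have "\<forall>\<^sub>F u in at_right 0. R < onorm (frechet_derivative h (at (p u)))"
    by (simp add: filterlim_at_top_dense)
  moreover have "\<forall>\<^sub>F u in at_right (0::real). 0 < u \<and> u < 1"
    unfolding eventually_at_right_field by (intro exI[of _ 1]) auto
  ultimately have "\<forall>\<^sub>F u in at_right (0::real). False"
    by eventually_elim (use bound in force)
  then show False by simp
qed

text \<open>A common interface for both smoothness alternatives: \<open>U\<close> is the orthant, or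
  its part in the interior of the domain of \<open>h\<close>. Every mirror step lands in
  \<open>U\<close>, but the initial point may lie outside. Closure under segments with
  \<open>u < 1\<close> keeps the difference quotients in \<open>U\<close> that are used for
  measurability.\<close>

locale mirror_map =
  fixes \<sigma> :: real and h :: "real ^ 'm::finite \<Rightarrow> real" and U :: "(real ^ 'm) set"
  assumes \<sigma>_pos: "0 < \<sigma>"
    and strongly_convex: "strongly_convex_l1_on {0..} \<sigma> h"
    and U_nonneg: "y \<in> U \<Longrightarrow> 0 \<le> y"
    and U_borel: "U \<in> sets borel"
    and U_differentiable: "y \<in> U \<Longrightarrow> h differentiable (at y within {0..})"
    and U_segment: "\<lbrakk>y \<in> U; 0 \<le> x; 0 \<le> u; u < 1\<rbrakk> \<Longrightarrow> y + u *\<^sub>R (x - y) \<in> U"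
    and U_arg_min: "\<lbrakk>0 < \<eta>; h differentiable (at y within {0..});
      is_arg_min (\<lambda>\<nu>. g \<bullet> \<nu> + 1 / \<eta> * bregman h \<nu> y) (\<lambda>\<nu>. 0 \<le> \<nu>) z\<rbrakk> \<Longrightarrow> z \<in> U"

text \<open>In the essentially smooth case \<open>h\<close> need not be differentiable at points of the boundary,
  but the iterates stay in the interior of its domain.\<close>

lemma reference_function_mirror_map:
  fixes h :: "real ^ 'm::finite \<Rightarrow> real"
  assumes "reference_function \<sigma> h"
  shows "\<exists>U. mirror_map \<sigma> h U"
proof -
  have \<sigma>: "0 < \<sigma>" "strongly_convex_l1_on {0..} \<sigma> h"
    using assms by (auto simp: reference_function_def)
  consider "h differentiable_on {0..}" | D where "{0..} \<subseteq> D" "essentially_smooth_on D h"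
    using assms by (auto simp: reference_function_def)
  then show ?thesis
  proof cases
    case 1
    have "mirror_map \<sigma> h {0..}"
    proof
      fix y x :: "real ^ 'm" and u :: real
      assume "y \<in> {0..}" "0 \<le> x" "0 \<le> u" "u < 1"
      then have "(1 - u) *\<^sub>R y + u *\<^sub>R x \<in> {0..}"
        using convexD_alt[OF convex_orthant, of y x u] by auto
      then show "y + u *\<^sub>R (x - y) \<in> {0..}" by (simp add: algebra_simps)
    qed (use \<sigma> 1 in \<open>auto simp: differentiable_on_def is_arg_min_def\<close>)
    then show ?thesis ..
  next
    case 2
    have "mirror_map \<sigma> h (interior D \<inter> {0..})"
    proof
      show "interior D \<inter> {0..} \<in> sets borel" by (intro sets.Int) auto
    next
      fix y assume "y \<in> interior D \<inter> {0..}"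
      then show "h differentiable (at y within {0..})"
        using 2(2) by (auto simp: essentially_smooth_on_def intro: differentiable_at_withinI)
    next
      fix y x :: "real ^ 'm" and u :: real
      assume *: "y \<in> interior D \<inter> {0..}" "0 \<le> x" "0 \<le> u" "u < 1"
      then have "(1 - u) *\<^sub>R y + u *\<^sub>R x \<in> {0..}"
        using convexD_alt[OF convex_orthant, of y x u] by auto
      then have "y + u *\<^sub>R (x - y) \<in> {0..}" by (simp add: algebra_simps)
      \<comment> \<open>The same point, seen as \<open>x\<close> moved by the positive fraction
        \<open>1 - u\<close> towards the interior point \<open>y\<close>.\<close>
      moreover have "x - (1 - u) *\<^sub>R (x - y) \<in> interior D"
        using * 2 by (intro mem_interior_convex_shrink) (auto simp: essentially_smooth_on_def)
      ultimately show "y + u *\<^sub>R (x - y) \<in> interior D \<inter> {0..}" by (simp add: algebra_simps)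
    next
      fix \<eta> :: real and g y z :: "real ^ 'm"
      assume \<eta>: "0 < \<eta>" and y: "h differentiable (at y within {0..})"
        and z: "is_arg_min (\<lambda>\<nu>. g \<bullet> \<nu> + 1 / \<eta> * bregman h \<nu> y) (\<lambda>\<nu>. 0 \<le> \<nu>) z"
      let ?D = "frechet_derivative h (at y within {0..})"
      have lin: "linear ?D" using y frechet_derivative_works has_derivative_linear by blast
      \<comment> \<open>Multiplying the objective by \<open>\<eta>\<close> and dropping constants
        leaves \<open>h\<close> plus this linear function.\<close>
      let ?L = "\<lambda>\<nu>. \<eta> * (g \<bullet> \<nu>) - ?D \<nu>"
      have "z \<in> interior D"
      proof (rule essentially_smooth_minimizer_interior[OF 2(2,1)])
        show "linear ?L"
          by (intro linear_compose_sub lin)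
            (auto intro!: linearI simp: inner_add_right algebra_simps)
        show "0 \<le> z" using z by (simp add: is_arg_min_def)
        fix \<nu> :: "real ^ 'm" assume "0 \<le> \<nu>"
        then have "g \<bullet> z + 1 / \<eta> * bregman h z y \<le> g \<bullet> \<nu> + 1 / \<eta> * bregman h \<nu> y"
          using z by (auto simp: is_arg_min_linorder)
        then have "\<eta> * (g \<bullet> z) + bregman h z y \<le> \<eta> * (g \<bullet> \<nu>) + bregman h \<nu> y"
          using \<eta> mult_left_mono[of _ _ \<eta>] by (fastforce simp: distrib_left)
        then show "?L z + h z \<le> ?L \<nu> + h \<nu>"
          by (simp add: bregman_def linear_diff[OF lin])
      qed
      then show "z \<in> interior D \<inter> {0..}" using z by (simp add: is_arg_min_def)
    qed (use \<sigma> in auto)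
    then show ?thesis ..
  qed
qed

section \<open>Inequalities for a single mirror step\<close>

lemma mirror_objective_has_derivative:
  assumes y: "h differentiable (at y within {0..})" and z: "h differentiable (at z within {0..})"
  shows "((\<lambda>\<nu>. g \<bullet> \<nu> + 1 / \<eta> * bregman h \<nu> y) has_derivative
      (\<lambda>v. g \<bullet> v + 1 / \<eta> * (frechet_derivative h (at z within {0..}) v
        - frechet_derivative h (at y within {0..}) v))) (at z within {0..})"
proof -
  have hz: "(h has_derivative frechet_derivative h (at z within {0..})) (at z within {0..})"
    using z frechet_derivative_works by blast
  have lin: "bounded_linear (frechet_derivative h (at y within {0..}))"
    using y frechet_derivative_works has_derivative_bounded_linear by blast
  show ?thesis
    unfolding bregman_def
    by (rule derivative_eq_intros bounded_linear.has_derivative[OF lin] hz refl)+ auto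
qed

context mirror_map begin

text \<open>First-order optimality of \<open>z\<close>, rewritten by the three-point identity for
  Bregman divergences.\<close>

lemma mirror_step_three_point:
  assumes "0 < \<eta>" and y: "h differentiable (at y within {0..})"
    and z: "is_arg_min (\<lambda>\<nu>. g \<bullet> \<nu> + 1 / \<eta> * bregman h \<nu> y) (\<lambda>\<nu>. 0 \<le> \<nu>) z"
    and "0 \<le> x"
  shows "g \<bullet> z + 1 / \<eta> * bregman h z y + 1 / \<eta> * bregman h x z \<le> g \<bullet> x + 1 / \<eta> * bregman h x y"
proof -
  let ?Dy = "frechet_derivative h (at y within {0..})"
  let ?Dz = "frechet_derivative h (at z within {0..})"
  have lin: "linear ?Dy" using y frechet_derivative_works has_derivative_linear by blast
  have "h differentiable (at z within {0..})"
    using U_differentiable U_arg_min assms by blast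
  from has_derivative_ge_of_minimum[OF mirror_objective_has_derivative[OF y this] convex_orthant]
  have "0 \<le> g \<bullet> (x - z) + 1 / \<eta> * (?Dz (x - z) - ?Dy (x - z))"
    using z assms by (simp add: is_arg_min_linorder)
  moreover have "?Dy (x - z) = ?Dy (x - y) - ?Dy (z - y)"
    by (simp flip: linear_diff[OF lin])
  ultimately show ?thesis
    by (simp add: bregman_def inner_diff_right algebra_simps)
qed

lemma mirror_step_differentiable:
  assumes "0 < \<eta>" "h differentiable (at y within {0..})"
    "is_arg_min (\<lambda>\<nu>. g \<bullet> \<nu> + 1 / \<eta> * bregman h \<nu> y) (\<lambda>\<nu>. 0 \<le> \<nu>) z"
  shows "h differentiable (at z within {0..})"
  using assms U_arg_min U_differentiable by blast

text \<open>The divergence from \<open>z\<close> in the three-point inequality is bounded below by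
  strong convexity. This growth around the minimiser yields uniqueness, the bound on the movement
  and measurability.\<close>

lemma mirror_step_growth:
  assumes "0 < \<eta>" "h differentiable (at y within {0..})"
    and z: "is_arg_min (\<lambda>\<nu>. g \<bullet> \<nu> + 1 / \<eta> * bregman h \<nu> y) (\<lambda>\<nu>. 0 \<le> \<nu>) z" and "0 \<le> x"
  shows "g \<bullet> z + 1 / \<eta> * bregman h z y + \<sigma> / (2 * \<eta>) * (l1_norm (x - z))\<^sup>2
    \<le> g \<bullet> x + 1 / \<eta> * bregman h x y"
proof -
  have "0 \<le> z" using z by (simp add: is_arg_min_def)
  have "1 / \<eta> * (\<sigma> / 2 * (l1_norm (x - z))\<^sup>2) \<le> 1 / \<eta> * bregman h x z"
    using assms mirror_step_differentiable[OF assms(1-3)] \<open>0 \<le> z\<close>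
    by (intro mult_left_mono bregman_ge strongly_convex) auto
  then show ?thesis using mirror_step_three_point[OF assms] by simp
qed

lemma mirror_step_unique:
  assumes "0 < \<eta>" "h differentiable (at y within {0..})"
    and z: "is_arg_min (\<lambda>\<nu>. g \<bullet> \<nu> + 1 / \<eta> * bregman h \<nu> y) (\<lambda>\<nu>. 0 \<le> \<nu>) z"
      "is_arg_min (\<lambda>\<nu>. g \<bullet> \<nu> + 1 / \<eta> * bregman h \<nu> y) (\<lambda>\<nu>. 0 \<le> \<nu>) z'"
  shows "z = z'"
proof -
  have "0 \<le> z" "0 \<le> z'" using z by (auto simp: is_arg_min_def)
  then have "\<sigma> / (2 * \<eta>) * (l1_norm (z' - z))\<^sup>2 \<le> 0"
    using mirror_step_growth[OF assms(1-3), of z'] z(2) by (force simp: is_arg_min_linorder)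
  moreover have "0 < \<sigma> / (2 * \<eta>)" using \<sigma>_pos assms(1) by simp
  ultimately have "(l1_norm (z' - z))\<^sup>2 \<le> 0" by (simp only: mult_le_0_iff) linarith
  then have "norm (z' - z) \<le> 0" using norm_le_l1_norm[of "z' - z"] by simp
  then show ?thesis by simp
qed

text \<open>Compare \<open>z\<close> with the starting point \<open>y\<close> itself. Both the
  growth term and the divergence of \<open>z\<close> from \<open>y\<close> contribute a quadratic
  term; with only one of them the bound would be twice as large.\<close>

lemma mirror_step_movement:
  assumes "0 < \<eta>" and y: "h differentiable (at y within {0..})" "0 \<le> y"
    and z: "is_arg_min (\<lambda>\<nu>. g \<bullet> \<nu> + 1 / \<eta> * bregman h \<nu> y) (\<lambda>\<nu>. 0 \<le> \<nu>) z"
    and g: "\<And>j. \<bar>g $ j\<bar> \<le> G"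
  shows "l1_norm (z - y) \<le> \<eta> * G / \<sigma>"
proof -
  let ?n = "l1_norm (z - y)"
  have "0 \<le> z" using z by (simp add: is_arg_min_def)
  have lin: "linear (frechet_derivative h (at y within {0..}))"
    using y frechet_derivative_works has_derivative_linear by blast
  have "1 / \<eta> * (\<sigma> / 2 * ?n\<^sup>2) \<le> 1 / \<eta> * bregman h z y"
    using assms(1) y \<open>0 \<le> z\<close> by (intro mult_left_mono bregman_ge strongly_convex) auto
  with mirror_step_growth[OF assms(1) y(1) z y(2)]
  have "\<sigma> / (2 * \<eta>) * ?n\<^sup>2 + \<sigma> / (2 * \<eta>) * ?n\<^sup>2 \<le> g \<bullet> (y - z)"
    using linear_0[OF lin]
    by (simp add: bregman_def l1_norm_minus_commute[of y] inner_diff_right field_simps)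
  also have "\<dots> \<le> G * ?n"
    using inner_le_l1_norm[of g G "y - z"] g by (simp add: l1_norm_minus_commute[of y])
  finally have *: "(\<sigma> * ?n) * ?n \<le> (\<eta> * G) * ?n" using assms(1) by (simp add: field_simps power2_eq_square)
  show ?thesis
  proof (cases "?n = 0")
    case True
    have "0 \<le> G" using g by (meson abs_ge_zero order_trans)
    then show ?thesis using True assms(1) \<sigma>_pos by simp
  next
    case False
    then have "\<sigma> * ?n \<le> \<eta> * G" using * l1_norm_nonneg[of "z - y"] by simp
    then show ?thesis using \<sigma>_pos by (simp add: field_simps)
  qed
qed

text \<open>Split \<open>g \<bullet> (y - x)\<close> at \<open>z\<close>. The three-point inequality
  leaves a negative quadratic term in \<open>z - y\<close>, which absorbs
  \<open>g \<bullet> (y - z)\<close> by Young's inequality.\<close>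

lemma mirror_step_regret:
  assumes "0 < \<eta>" and y: "h differentiable (at y within {0..})" "0 \<le> y"
    and z: "is_arg_min (\<lambda>\<nu>. g \<bullet> \<nu> + 1 / \<eta> * bregman h \<nu> y) (\<lambda>\<nu>. 0 \<le> \<nu>) z"
    and g: "\<And>j. \<bar>g $ j\<bar> \<le> G" and "0 \<le> x"
  shows "g \<bullet> (y - x) \<le> \<eta> * G\<^sup>2 / (2 * \<sigma>) + (bregman h x y - bregman h x z) / \<eta>"
proof -
  let ?n = "l1_norm (z - y)"
  have "0 \<le> z" using z by (simp add: is_arg_min_def)
  have "1 / \<eta> * (\<sigma> / 2 * ?n\<^sup>2) \<le> 1 / \<eta> * bregman h z y"
    using assms(1) y \<open>0 \<le> z\<close> by (intro mult_left_mono bregman_ge strongly_convex) auto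
  with mirror_step_three_point[OF assms(1) y(1) z \<open>0 \<le> x\<close>]
  have "g \<bullet> (z - x) \<le> (bregman h x y - bregman h x z) / \<eta> - \<sigma> / (2 * \<eta>) * ?n\<^sup>2"
    by (simp add: inner_diff_right diff_divide_distrib)
  moreover have "g \<bullet> (y - z) \<le> G * ?n"
    using inner_le_l1_norm[of g G "y - z"] g by (simp add: l1_norm_minus_commute[of y])
  moreover have "G * ?n \<le> \<eta> * G\<^sup>2 / (2 * \<sigma>) + \<sigma> / (2 * \<eta>) * ?n\<^sup>2"
  proof -
    have "0 \<le> (\<eta> * G - \<sigma> * ?n)\<^sup>2 / (2 * \<sigma> * \<eta>)" using assms(1) \<sigma>_pos by simp
    also have "\<dots> = \<eta> * G\<^sup>2 / (2 * \<sigma>) + \<sigma> / (2 * \<eta>) * ?n\<^sup>2 - G * ?n"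
      using assms(1) \<sigma>_pos by (simp add: field_simps power2_eq_square)
    finally show ?thesis by simp
  qed
  ultimately show ?thesis by (simp add: inner_diff_right)
qed

end

section \<open>Pathwise analysis of dual mirror descent\<close>

lemma inner_nonneg_vec:
  fixes x y :: "real ^ 'n"
  assumes "0 \<le> x" "0 \<le> y"
  shows "0 \<le> x \<bullet> y"
  using assms by (simp add: inner_vec_def less_eq_vec_def sum_nonneg)

lemma opt_reward_eq:
  assumes "is_arg_max (\<lambda>x. reward g x - \<mu> \<bullet> consumption g x) (\<lambda>x. x \<in> feasible g) z"
  shows "opt_reward g \<mu> = reward g z - \<mu> \<bullet> consumption g z"
  unfolding opt_reward_def
  using assms by (intro cSup_eq_maximum) (auto simp: is_arg_max_linorder)

context
  fixes S :: "('d::finite, 'm::finite) request set" and fbar bbar :: real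
  assumes bounded: "bounded_requests S fbar bbar"
    and requests: "\<And>g. g \<in> S \<Longrightarrow> is_request g"
begin

lemma fbar_nonneg: "0 \<le> fbar" and bbar_nonneg: "0 \<le> bbar"
  using bounded by (auto simp: bounded_requests_def)

lemma request_bounds:
  assumes "g \<in> S" "x \<in> feasible g"
  shows "0 \<le> reward g x" "reward g x \<le> fbar" "0 \<le> consumption g x"
    "0 \<le> consumption g x $ j" "consumption g x $ j \<le> bbar"
proof -
  show c: "0 \<le> reward g x" "reward g x \<le> fbar" "0 \<le> consumption g x"
    using bounded assms by (auto simp: bounded_requests_def)
  then show "0 \<le> consumption g x $ j" by (simp add: less_eq_vec_def)
  have "\<bar>consumption g x $ j\<bar> \<le> infnorm (consumption g x)" by (rule component_le_infnorm_cart)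
  also have "\<dots> \<le> bbar" using bounded assms by (auto simp: bounded_requests_def)
  finally show "consumption g x $ j \<le> bbar" by simp
qed

lemma opt_reward_attained:
  assumes "g \<in> S" "0 \<le> \<mu>"
  obtains z where "is_arg_max (\<lambda>x. reward g x - \<mu> \<bullet> consumption g x) (\<lambda>x. x \<in> feasible g) z"
  using bounded assms that unfolding bounded_requests_def by blast

lemma opt_reward_ge:
  assumes "g \<in> S" "0 \<le> \<mu>" "x \<in> feasible g"
  shows "reward g x - \<mu> \<bullet> consumption g x \<le> opt_reward g \<mu>"
proof -
  obtain z where z: "is_arg_max (\<lambda>x. reward g x - \<mu> \<bullet> consumption g x) (\<lambda>x. x \<in> feasible g) z"
    using opt_reward_attained[OF assms(1,2)] .
  then show ?thesis using opt_reward_eq[OF z] assms(3) by (simp add: is_arg_max_linorder)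
qed

lemma opt_reward_nonneg:
  assumes "g \<in> S" "0 \<le> \<mu>"
  shows "0 \<le> opt_reward g \<mu>"
  using opt_reward_ge[OF assms, of 0] requests[OF assms(1)] by (auto simp: is_request_def)

lemma opt_reward_le:
  assumes "g \<in> S" "0 \<le> \<mu>"
  shows "opt_reward g \<mu> \<le> fbar"
proof -
  obtain z where z: "is_arg_max (\<lambda>x. reward g x - \<mu> \<bullet> consumption g x) (\<lambda>x. x \<in> feasible g) z"
    using opt_reward_attained[OF assms] .
  then have "z \<in> feasible g" by (simp add: is_arg_max_def)
  then show ?thesis
    using opt_reward_eq[OF z] request_bounds(2)[OF assms(1), of z]
      inner_nonneg_vec[OF assms(2) request_bounds(3)[OF assms(1), of z]] by linarith
qed

text \<open>The maximiser at \<open>\<mu>\<close> remains a candidate at \<open>\<nu>\<close>, and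
  its consumption is at most \<open>bbar\<close> in each resource. The constant is the source of the
  factor \<open>bbar\<close> in \<open>C4\<close>.\<close>

lemma opt_reward_lipschitz:
  assumes "g \<in> S" "0 \<le> \<mu>" "0 \<le> \<nu>"
  shows "opt_reward g \<mu> \<le> opt_reward g \<nu> + bbar * l1_norm (\<mu> - \<nu>)"
proof -
  obtain z where z: "is_arg_max (\<lambda>x. reward g x - \<mu> \<bullet> consumption g x) (\<lambda>x. x \<in> feasible g) z"
    using opt_reward_attained[OF assms(1,2)] .
  then have zf: "z \<in> feasible g" by (simp add: is_arg_max_def)
  have "opt_reward g \<mu> = reward g z - \<nu> \<bullet> consumption g z + consumption g z \<bullet> (\<nu> - \<mu>)"
    unfolding opt_reward_eq[OF z] by (simp add: inner_diff_right inner_commute)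
  also have "consumption g z \<bullet> (\<nu> - \<mu>) \<le> bbar * l1_norm (\<nu> - \<mu>)"
    by (rule inner_le_l1_norm) (use request_bounds[OF assms(1) zf] in auto)
  also have "reward g z - \<nu> \<bullet> consumption g z \<le> opt_reward g \<nu>"
    by (rule opt_reward_ge[OF assms(1,3) zf])
  finally show ?thesis by (simp add: l1_norm_minus_commute)
qed

text \<open>Weak duality: the budget constraint is priced by \<open>\<mu>\<close>, after which the
  periods decouple.\<close>

lemma OPT_le:
  assumes \<gamma>: "\<And>t. t \<in> {1..T} \<Longrightarrow> \<gamma> t \<in> S" and "0 \<le> \<rho>" "0 \<le> \<mu>"
  shows "OPT T \<rho> \<gamma> \<le> (\<Sum>t=1..T. opt_reward (\<gamma> t) \<mu>) + real T * (\<mu> \<bullet> \<rho>)"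
  unfolding OPT_def
proof (rule cSUP_least)
  have "(\<lambda>_. 0) \<in> {x. (\<forall>t\<in>{1..T}. x t \<in> feasible (\<gamma> t)) \<and>
      (\<Sum>t=1..T. consumption (\<gamma> t) (x t)) \<le> real T *\<^sub>R \<rho>}"
    using \<gamma> requests assms(2) by (auto simp: is_request_def scaleR_nonneg_nonneg)
  then show "{x. (\<forall>t\<in>{1..T}. x t \<in> feasible (\<gamma> t)) \<and>
      (\<Sum>t=1..T. consumption (\<gamma> t) (x t)) \<le> real T *\<^sub>R \<rho>} \<noteq> {}"
    unfolding ex_in_conv[symmetric] by (rule exI[of _ "\<lambda>_. 0"])
next
  fix x
  assume "x \<in> {x. (\<forall>t\<in>{1..T}. x t \<in> feasible (\<gamma> t)) \<and>
      (\<Sum>t=1..T. consumption (\<gamma> t) (x t)) \<le> real T *\<^sub>R \<rho>}"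
  then have x: "\<And>t. t \<in> {1..T} \<Longrightarrow> x t \<in> feasible (\<gamma> t)"
    and le: "0 \<le> real T *\<^sub>R \<rho> - (\<Sum>t=1..T. consumption (\<gamma> t) (x t))" by auto
  have "(\<Sum>t=1..T. reward (\<gamma> t) (x t))
      \<le> (\<Sum>t=1..T. opt_reward (\<gamma> t) \<mu> + \<mu> \<bullet> consumption (\<gamma> t) (x t))"
  proof (rule sum_mono)
    fix t assume "t \<in> {1..T}"
    then show "reward (\<gamma> t) (x t) \<le> opt_reward (\<gamma> t) \<mu> + \<mu> \<bullet> consumption (\<gamma> t) (x t)"
      using opt_reward_ge[OF \<gamma> assms(3) x, of t] by simp
  qed
  also have "\<dots> = (\<Sum>t=1..T. opt_reward (\<gamma> t) \<mu>) + \<mu> \<bullet> (\<Sum>t=1..T. consumption (\<gamma> t) (x t))"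
    by (simp add: sum.distrib inner_sum_right)
  also have "\<mu> \<bullet> (\<Sum>t=1..T. consumption (\<gamma> t) (x t)) \<le> real T * (\<mu> \<bullet> \<rho>)"
    using inner_nonneg_vec[OF assms(3) le] by (simp add: inner_diff_right)
  finally show "(\<Sum>t=1..T. reward (\<gamma> t) (x t))
      \<le> (\<Sum>t=1..T. opt_reward (\<gamma> t) \<mu>) + real T * (\<mu> \<bullet> \<rho>)" by simp
qed

text \<open>Weak duality with zero prices. It gives the crude regret bound for the degenerate cases
  \<open>\<eta> = 0\<close> and \<open>k > T\<close>.\<close>

lemma OPT_le_fbar:
  assumes "\<And>t. t \<in> {1..T} \<Longrightarrow> \<gamma> t \<in> S" "0 \<le> \<rho>"
  shows "OPT T \<rho> \<gamma> \<le> real T * fbar"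
proof -
  have "(\<Sum>t=1..T. opt_reward (\<gamma> t) 0) \<le> (\<Sum>t=1..T. fbar)"
    using assms by (intro sum_mono opt_reward_le) auto
  with OPT_le[of T \<gamma> \<rho> 0] assms show ?thesis by simp
qed

lemma decision_feasible:
  assumes "dual_mirror_descent T \<rho> h \<eta> \<mu>1 \<gamma> xt x B mu" "t \<in> {1..T}" "\<gamma> t \<in> S"
  shows "x t \<in> feasible (\<gamma> t)"
  using assms requests[OF assms(3)]
  by (auto simp: dual_mirror_descent_def is_arg_max_def is_request_def)

lemma rewards_nonneg:
  assumes "dual_mirror_descent T \<rho> h \<eta> \<mu>1 \<gamma> xt x B mu" "\<And>t. t \<in> {1..T} \<Longrightarrow> \<gamma> t \<in> S"
  shows "0 \<le> (\<Sum>t=1..T. reward (\<gamma> t) (x t))"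
  using request_bounds(1)[OF _ decision_feasible[OF assms(1)]] assms(2) by (intro sum_nonneg) auto

end

text \<open>While the total consumption leaves a reserve of \<open>bbar\<close> in every resource, no tentative
  decision can be rejected. Whether this holds in period \<open>t\<close> depends on the earlier periods only.\<close>

definition unconstrained :: "nat \<Rightarrow> real ^ 'm \<Rightarrow> real \<Rightarrow> (nat \<Rightarrow> real ^ 'm) \<Rightarrow> nat \<Rightarrow> bool" where
  "unconstrained T \<rho> bbar b t \<longleftrightarrow> (\<forall>j. (\<Sum>s=1..t-1. b s $ j) + bbar \<le> real T * \<rho> $ j)"

section \<open>A run of the algorithm along one fixed request sequence\<close>

locale descent_run = mirror_map \<sigma> h U
  for \<sigma> h and U :: "(real ^ 'm::finite) set" +
  fixes S :: "('d::finite, 'm) request set" and T :: nat and \<rho> \<mu>1 :: "real ^ 'm"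
    and fbar bbar \<eta> :: real and \<gamma> :: "nat \<Rightarrow> ('d, 'm) request" and xt x :: "nat \<Rightarrow> real ^ 'd"
    and B mu :: "nat \<Rightarrow> real ^ 'm"
  assumes \<rho>_pos: "\<And>j. 0 < \<rho> $ j"
    and requests: "\<And>g. g \<in> S \<Longrightarrow> is_request g"
    and bounded: "bounded_requests S fbar bbar"
    and \<eta>_pos: "0 < \<eta>"
    and \<mu>1: "0 \<le> \<mu>1" "h differentiable (at \<mu>1 within {0..})"
    and \<gamma>: "t \<in> {1..T} \<Longrightarrow> \<gamma> t \<in> S"
    and run: "dual_mirror_descent T \<rho> h \<eta> \<mu>1 \<gamma> xt x B mu"
begin

abbreviation b where "b t \<equiv> consumption (\<gamma> t) (xt t)"
abbreviation G where "G \<equiv> bbar + Max (range (\<lambda>j. \<rho> $ j))"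

lemma run_step:
  assumes "t \<in> {1..T}"
  shows "is_arg_max (\<lambda>z. reward (\<gamma> t) z - mu t \<bullet> consumption (\<gamma> t) z) (\<lambda>z. z \<in> feasible (\<gamma> t)) (xt t)"
    and "x t = (if b t \<le> B t then xt t else 0)"
    and "B (t + 1) = B t - consumption (\<gamma> t) (x t)"
    and "is_arg_min (\<lambda>\<nu>. (\<rho> - b t) \<bullet> \<nu> + 1 / \<eta> * bregman h \<nu> (mu t)) (\<lambda>\<nu>. 0 \<le> \<nu>) (mu (t + 1))"
  using run assms by (auto simp: dual_mirror_descent_def)

lemma xt_feasible: "t \<in> {1..T} \<Longrightarrow> xt t \<in> feasible (\<gamma> t)"
  using run_step(1) by (simp add: is_arg_max_def)

lemma x_feasible: "t \<in> {1..T} \<Longrightarrow> x t \<in> feasible (\<gamma> t)"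
  using decision_feasible[OF bounded requests run] \<gamma> by blast

lemma mu_good:
  assumes "t \<in> {1..T + 1}"
  shows "0 \<le> mu t" "h differentiable (at (mu t) within {0..})"
proof -
  have "0 \<le> mu (Suc n) \<and> h differentiable (at (mu (Suc n)) within {0..})" if "n \<le> T" for n
    using that
  proof (induction n)
    case 0
    then show ?case using \<mu>1 run by (simp add: dual_mirror_descent_def)
  next
    case (Suc n)
    then have "Suc n \<in> {1..T}" by simp
    from run_step(4)[OF this] Suc show ?case
      using mirror_step_differentiable[OF \<eta>_pos] by (fastforce simp: is_arg_min_def)
  qed
  from this[of "t - 1"] assms show "0 \<le> mu t" "h differentiable (at (mu t) within {0..})" by auto
qed

lemma mu_inner_nonneg: "t \<in> {1..T + 1} \<Longrightarrow> 0 \<le> mu t \<bullet> \<rho>"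
  using mu_good \<rho>_pos by (intro inner_nonneg_vec) (auto simp: less_eq_vec_def less_imp_le)

lemma subgradient_bound:
  assumes "t \<in> {1..T}"
  shows "\<bar>(\<rho> - b t) $ j\<bar> \<le> G"
proof -
  have "\<rho> $ j \<le> Max (range (\<lambda>j. \<rho> $ j))" by (intro Max_ge) auto
  then show ?thesis
    using request_bounds(4,5)[OF bounded requests \<gamma>[OF assms] xt_feasible[OF assms], where j=j] \<rho>_pos[of j]
    unfolding abs_le_iff vector_minus_component by (intro conjI; linarith)
qed

lemma G_nonneg: "0 \<le> G"
proof -
  fix j
  have "\<rho> $ j \<le> Max (range (\<lambda>j. \<rho> $ j))" by (intro Max_ge) auto
  then show ?thesis using \<rho>_pos[of j] bbar_nonneg[OF bounded requests] by linarith
qed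

lemma mu_movement:
  assumes "1 \<le> t" "t + k \<le> T + 1"
  shows "l1_norm (mu t - mu (t + k)) \<le> real k * (\<eta> * G / \<sigma>)"
  using assms(2)
proof (induction k)
  case 0
  then show ?case by (simp add: l1_norm_def)
next
  case (Suc k)
  then have *: "t + k \<in> {1..T}" using assms(1) by simp
  have "l1_norm (mu t - mu (t + Suc k))
      \<le> l1_norm (mu t - mu (t + k)) + l1_norm (mu (t + k) - mu (t + k + 1))"
    using l1_norm_triangle by simp
  also have "l1_norm (mu (t + k) - mu (t + k + 1)) \<le> \<eta> * G / \<sigma>"
    using mirror_step_movement[OF \<eta>_pos mu_good(2,1) run_step(4)[OF *] subgradient_bound[OF *]] *
    by (simp add: l1_norm_minus_commute)
  finally have "l1_norm (mu t - mu (t + Suc k)) \<le> l1_norm (mu t - mu (t + k)) + \<eta> * G / \<sigma>" by simp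
  moreover have "l1_norm (mu t - mu (t + k)) \<le> real k * (\<eta> * G / \<sigma>)" using Suc by simp
  moreover have "real (Suc k) * (\<eta> * G / \<sigma>) = real k * (\<eta> * G / \<sigma>) + \<eta> * G / \<sigma>"
    by (simp only: of_nat_Suc distrib_right mult_1_left)
  ultimately show ?case by linarith
qed

text \<open>The single-step bounds telescope; the divergence from the last iterate is nonnegative
  and is dropped at the end. An arbitrary prefix length is allowed, because the sum is later cut at
  the stopping time.\<close>

lemma mirror_regret:
  assumes "n \<le> T" "0 \<le> \<nu>"
  shows "(\<Sum>t=1..n. (\<rho> - b t) \<bullet> (mu t - \<nu>))
    \<le> real n * (\<eta> * G\<^sup>2 / (2 * \<sigma>)) + bregman h \<nu> \<mu>1 / \<eta>"
proof -
  have "(\<Sum>t=1..n. (\<rho> - b t) \<bullet> (mu t - \<nu>))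
      \<le> real n * (\<eta> * G\<^sup>2 / (2 * \<sigma>)) + (bregman h \<nu> \<mu>1 - bregman h \<nu> (mu (n + 1))) / \<eta>"
    using assms(1)
  proof (induction n)
    case 0
    then show ?case using run by (simp add: dual_mirror_descent_def)
  next
    case (Suc n)
    then have *: "n + 1 \<in> {1..T}" by simp
    have "(\<rho> - b (n + 1)) \<bullet> (mu (n + 1) - \<nu>) \<le> \<eta> * G\<^sup>2 / (2 * \<sigma>)
        + (bregman h \<nu> (mu (n + 1)) - bregman h \<nu> (mu (n + 1 + 1))) / \<eta>"
      using * by (intro mirror_step_regret[OF \<eta>_pos mu_good(2,1) run_step(4)[OF *]
            subgradient_bound[OF *] assms(2)]) auto
    moreover have "real (Suc n) * (\<eta> * G\<^sup>2 / (2 * \<sigma>))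
        = real n * (\<eta> * G\<^sup>2 / (2 * \<sigma>)) + \<eta> * G\<^sup>2 / (2 * \<sigma>)"
      by (simp only: of_nat_Suc distrib_right mult_1_left)
    ultimately show ?case
      using Suc unfolding diff_divide_distrib by simp
  qed
  moreover have "0 \<le> bregman h \<nu> (mu (n + 1))"
  proof -
    have "0 \<le> \<sigma> / 2 * (l1_norm (\<nu> - mu (n + 1)))\<^sup>2" using \<sigma>_pos by simp
    also have "\<dots> \<le> bregman h \<nu> (mu (n + 1))"
      using mu_good assms by (intro bregman_ge[OF strongly_convex]) auto
    finally show ?thesis .
  qed
  ultimately show ?thesis using \<eta>_pos
    by (smt (verit) divide_right_mono)
qed

lemma unconstrained_antimono:
  assumes "unconstrained T \<rho> bbar b t" "s \<le> t" "t \<le> T"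
  shows "unconstrained T \<rho> bbar b s"
  unfolding unconstrained_def
proof
  fix j
  have "(\<Sum>s=1..s-1. b s $ j) \<le> (\<Sum>s=1..t-1. b s $ j)"
    using assms request_bounds[OF bounded requests \<gamma> xt_feasible]
    by (intro sum_mono2) auto
  then show "(\<Sum>s=1..s-1. b s $ j) + bbar \<le> real T * \<rho> $ j"
    using assms(1) by (auto simp: unconstrained_def intro: order_trans[OF add_right_mono])
qed

lemma stopping_time:
  obtains N where "N \<le> T" "\<And>t. t \<in> {1..T} \<Longrightarrow> unconstrained T \<rho> bbar b t \<longleftrightarrow> t \<le> N"
proof -
  \<comment> \<open>\<open>N\<close> counts the unconstrained periods, hence the shift by one; it is
    \<open>0\<close> if the reserve is missing from the start. The alternative \<open>t = T\<close>
    makes the least element exist.\<close>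
  define N where "N = (LEAST t. \<not> unconstrained T \<rho> bbar b (t + 1) \<or> t = T)"
  have N: "\<not> unconstrained T \<rho> bbar b (N + 1) \<or> N = T"
    unfolding N_def by (rule LeastI[of _ T]) simp
  have least: "unconstrained T \<rho> bbar b (t + 1)" if "t < N" for t
    using not_less_Least[OF that[unfolded N_def]] by simp
  have "N \<le> T" unfolding N_def by (rule Least_le) simp
  moreover have "unconstrained T \<rho> bbar b t \<longleftrightarrow> t \<le> N" if "t \<in> {1..T}" for t
    using that N least[of "t - 1"] unconstrained_antimono[of t "N + 1"] by (cases "t \<le> N") auto
  ultimately show ?thesis using that by blast
qed

text \<open>The property \<open>unconstrained\<close> refers to tentative consumptions. By induction
  no earlier decision was rejected, so the remaining budget is expressed by the same sum, and the
  reserve covers one further consumption.\<close>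

lemma decision_unconstrained:
  assumes "t \<in> {1..T}" "unconstrained T \<rho> bbar b t"
  shows "x t = xt t"
proof -
  have B: "B (n + 1) = real T *\<^sub>R \<rho> - (\<Sum>s=1..n. b s)"
    if "n < T" "unconstrained T \<rho> bbar b (n + 1)" for n
    using that
  proof (induction n)
    case 0
    then show ?case using run by (simp add: dual_mirror_descent_def)
  next
    case (Suc n)
    have n: "Suc n \<in> {1..T}" using Suc.prems by simp
    have unc: "unconstrained T \<rho> bbar b (n + 1)"
      using unconstrained_antimono[OF Suc.prems(2), of "n + 1"] Suc.prems by simp
    have BS: "B (n + 1) = real T *\<^sub>R \<rho> - (\<Sum>s=1..n. b s)" using Suc unc by simp
    have "b (n + 1) \<le> B (n + 1)"
      unfolding less_eq_vec_def
    proof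
      fix j
      show "b (n + 1) $ j \<le> B (n + 1) $ j"
        using unc[unfolded unconstrained_def, rule_format, of j]
          request_bounds(5)[OF bounded requests \<gamma>[OF n] xt_feasible[OF n], where j=j] BS by simp
    qed
    then show ?case using run_step(2,3)[OF n] BS by simp
  qed
  have Bt: "B t = real T *\<^sub>R \<rho> - (\<Sum>s=1..t - 1. b s)"
    using B[of "t - 1"] assms by auto
  have "b t \<le> B t"
    unfolding less_eq_vec_def
  proof
    fix j
    show "b t $ j \<le> B t $ j"
      using assms(2)[unfolded unconstrained_def, rule_format, of j] 
        request_bounds(5)[OF bounded requests \<gamma>[OF assms(1)] xt_feasible[OF assms(1)], where j=j]
      by (simp add: Bt)
  qed
  then show ?thesis using run_step(2)[OF assms(1)] by simp
qed

lemma opt_reward_run: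
  assumes "t \<in> {1..T}"
  shows "opt_reward (\<gamma> t) (mu t) = reward (\<gamma> t) (xt t) - mu t \<bullet> b t"
  using opt_reward_eq[OF run_step(1)[OF assms]] .

lemma opt_reward_lag:
  assumes "1 \<le> t" "t + k \<le> T"
  shows "opt_reward (\<gamma> (t + k)) (mu t)
    \<le> opt_reward (\<gamma> (t + k)) (mu (t + k)) + bbar * (real k * (\<eta> * G / \<sigma>))"
proof -
  have "opt_reward (\<gamma> (t + k)) (mu t)
      \<le> opt_reward (\<gamma> (t + k)) (mu (t + k)) + bbar * l1_norm (mu t - mu (t + k))"
    using assms by (intro opt_reward_lipschitz[OF bounded requests] \<gamma> mu_good) auto
  also have "bbar * l1_norm (mu t - mu (t + k)) \<le> bbar * (real k * (\<eta> * G / \<sigma>))"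
    using mu_movement[of t k] assms bbar_nonneg[OF bounded requests] by (intro mult_left_mono) auto
  finally show ?thesis by simp
qed

text \<open>The comparator is \<open>0\<close> if the budget is never tight, and otherwise the multiple
  \<open>fbar / \<rho>\<^sub>j\<close> of the unit vector of a resource \<open>j\<close> that is nearly exhausted.\<close>

lemma stopped_regret:
  assumes "N \<le> T" "\<And>t. t \<in> {1..T} \<Longrightarrow> unconstrained T \<rho> bbar b t \<longleftrightarrow> t \<le> N"
  shows "(\<Sum>t=1..N. (\<rho> - b t) \<bullet> mu t)
    \<le> real T * (\<eta> * G\<^sup>2 / (2 * \<sigma>))
      + Max ((\<lambda>\<mu>. bregman h \<mu> \<mu>1) ` ({0} \<union> range (\<lambda>j. (fbar / \<rho> $ j) *\<^sub>R axis j 1))) / \<eta>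
      + fbar * bbar / Min (range (\<lambda>j. \<rho> $ j)) - fbar * real (T - N)"
proof -
  let ?W = "{0} \<union> range (\<lambda>j. (fbar / \<rho> $ j) *\<^sub>R axis j 1) :: (real ^ 'm) set"
  have f0: "0 \<le> fbar" and b0: "0 \<le> bbar"
    using fbar_nonneg[OF bounded requests] bbar_nonneg[OF bounded requests] by auto
  have Min: "0 < Min (range (\<lambda>j. \<rho> $ j))" using \<rho>_pos by (subst Min_gr_iff) auto
  obtain \<nu> where \<nu>: "\<nu> \<in> ?W" "0 \<le> \<nu>"
    and le: "(\<Sum>t=1..N. (\<rho> - b t) \<bullet> \<nu>) \<le> fbar * bbar / Min (range (\<lambda>j. \<rho> $ j)) - fbar * real (T - N)"
  proof (cases "N = T")
    case True
    moreover have "0 \<le> fbar * bbar / Min (range (\<lambda>j. \<rho> $ j))"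
      using Min f0 b0 by (intro divide_nonneg_pos mult_nonneg_nonneg)
    ultimately show ?thesis by (intro that[of 0]) simp_all
  next
    case False
    then have "\<not> unconstrained T \<rho> bbar b (N + 1)" using assms by simp
    then obtain j where j: "real T * \<rho> $ j < (\<Sum>s=1..N. b s $ j) + bbar"
      by (auto simp: unconstrained_def not_le)
    \<comment> \<open>The price makes the budget share \<open>\<rho> $ j\<close> of each of the
      \<open>T - N\<close> lost periods worth exactly \<open>fbar\<close>. Resource \<open>j\<close>
      is used up except for less than \<open>bbar\<close>, which costs
      \<open>fbar * bbar / \<rho> $ j\<close> and gives \<open>C1\<close>.\<close>
    let ?\<nu> = "(fbar / \<rho> $ j) *\<^sub>R axis j 1 :: real ^ 'm"
    have "(\<Sum>t=1..N. (\<rho> - b t) \<bullet> ?\<nu>) = fbar / \<rho> $ j * (real N * \<rho> $ j - (\<Sum>s=1..N. b s $ j))"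
      by (simp add: inner_axis sum_distrib_left sum_subtractf right_diff_distrib)
    also have "\<dots> \<le> fbar / \<rho> $ j * (bbar - real (T - N) * \<rho> $ j)"
      using j assms(1) f0 \<rho>_pos[of j] by (intro mult_left_mono) (auto simp: of_nat_diff left_diff_distrib)
    also have "\<dots> = fbar * bbar / \<rho> $ j - fbar * real (T - N)"
      using \<rho>_pos[of j] by (simp add: field_simps)
    also have "fbar * bbar / \<rho> $ j \<le> fbar * bbar / Min (range (\<lambda>j. \<rho> $ j))"
      using Min f0 b0 by (intro divide_left_mono mult_pos_pos \<rho>_pos) auto
    finally have "(\<Sum>t=1..N. (\<rho> - b t) \<bullet> ?\<nu>)
        \<le> fbar * bbar / Min (range (\<lambda>j. \<rho> $ j)) - fbar * real (T - N)" by simp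
    moreover have "0 \<le> ?\<nu>"
      using f0 \<rho>_pos[of j] by (auto simp: less_eq_vec_def axis_def)
    ultimately show ?thesis using that[of ?\<nu>] by blast
  qed
  have "(\<Sum>t=1..N. (\<rho> - b t) \<bullet> mu t)
      = (\<Sum>t=1..N. (\<rho> - b t) \<bullet> (mu t - \<nu>)) + (\<Sum>t=1..N. (\<rho> - b t) \<bullet> \<nu>)"
    by (simp add: inner_diff_right flip: sum.distrib)
  moreover have "bregman h \<nu> \<mu>1 / \<eta> \<le> Max ((\<lambda>\<mu>. bregman h \<mu> \<mu>1) ` ?W) / \<eta>"
    using \<nu>(1) \<eta>_pos by (intro divide_right_mono Max_ge) auto
  moreover have "real N * (\<eta> * G\<^sup>2 / (2 * \<sigma>)) \<le> real T * (\<eta> * G\<^sup>2 / (2 * \<sigma>))"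
    using assms(1) \<eta>_pos \<sigma>_pos by (intro mult_right_mono) auto
  ultimately show ?thesis using mirror_regret[OF assms(1) \<nu>(2)] le by linarith
qed

text \<open>Up to the stopping time the reward is the dual function minus complementary slackness.
  Delaying the requests by \<open>k\<close> periods makes the dual iterate a function of the history on
  which the request is conditioned; it costs at most \<open>k\<close> unmatched terms and the drift of the iterates.\<close>

lemma reward_lower_bound:
  assumes "k \<le> T" and c: "0 \<le> c" "c \<le> fbar"
  shows "real T * c + (\<Sum>t=1..T - k. if unconstrained T \<rho> bbar b t
        then opt_reward (\<gamma> (t + k)) (mu t) + mu t \<bullet> \<rho> - c else 0)
    \<le> (\<Sum>t=1..T. reward (\<gamma> t) (x t)) + fbar * bbar / Min (range (\<lambda>j. \<rho> $ j))
      + real T * (\<eta> * G\<^sup>2 / (2 * \<sigma>))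
      + Max ((\<lambda>\<mu>. bregman h \<mu> \<mu>1) ` ({0} \<union> range (\<lambda>j. (fbar / \<rho> $ j) *\<^sub>R axis j 1))) / \<eta>
      + real T * (bbar * (real k * (\<eta> * G / \<sigma>))) + fbar * real k"
proof -
  obtain N where N: "N \<le> T" "\<And>t. t \<in> {1..T} \<Longrightarrow> unconstrained T \<rho> bbar b t \<longleftrightarrow> t \<le> N"
    using stopping_time by blast
  \<comment> \<open>A term survives only if its period is unconstrained and its lagged request still
    lies within the horizon.\<close>
  define n where "n = min N (T - k)"
  define F where "F t = opt_reward (\<gamma> t) (mu t)" for t
  define L where "L = bbar * (real k * (\<eta> * G / \<sigma>))"
  have f0: "0 \<le> fbar" and b0: "0 \<le> bbar"
    using fbar_nonneg[OF bounded requests] bbar_nonneg[OF bounded requests] by auto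
  have "0 \<le> L" unfolding L_def using b0 G_nonneg \<eta>_pos \<sigma>_pos by simp
  have F: "0 \<le> F t" "F t \<le> fbar" if "t \<in> {1..T}" for t
    using that opt_reward_nonneg[OF bounded requests \<gamma> mu_good(1)]
      opt_reward_le[OF bounded requests \<gamma> mu_good(1)] by (auto simp: F_def)
  have n: "n \<le> N" "n + k \<le> T" "N \<le> n + k" using assms N(1) by (auto simp: n_def)

  have "(\<Sum>t=1..T - k. if unconstrained T \<rho> bbar b t
        then opt_reward (\<gamma> (t + k)) (mu t) + mu t \<bullet> \<rho> - c else 0)
      = (\<Sum>t\<in>{1..T - k}. if t \<le> N then opt_reward (\<gamma> (t + k)) (mu t) + mu t \<bullet> \<rho> - c else 0)"
    using N(2) by (intro sum.cong refl if_cong) auto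
  also have "\<dots> = (\<Sum>t\<in>{t\<in>{1..T - k}. t \<le> N}. opt_reward (\<gamma> (t + k)) (mu t) + mu t \<bullet> \<rho> - c)"
    by (intro sum.inter_filter[symmetric]) simp
  also have "{t\<in>{1..T - k}. t \<le> N} = {1..n}" by (auto simp: n_def)
  also have "(\<Sum>t=1..n. opt_reward (\<gamma> (t + k)) (mu t) + mu t \<bullet> \<rho> - c)
      \<le> (\<Sum>t=1..n. F (t + k) + L + mu t \<bullet> \<rho> - c)"
    using opt_reward_lag[of _ k] n(2) by (intro sum_mono) (auto simp: F_def L_def)
  also have "\<dots> = (\<Sum>t=1..n. F (t + k)) + real n * L + (\<Sum>t=1..n. mu t \<bullet> \<rho>) - real n * c"
    by (simp add: sum.distrib sum_subtractf)
  \<comment> \<open>Reindexed by request, the range \<open>1+k..n+k\<close> is replaced by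
    \<open>1..N\<close>: the first \<open>k\<close> terms are added since \<open>F\<close> is
    nonnegative, and those beyond \<open>N\<close> cost \<open>fbar\<close> each.\<close>
  also have "(\<Sum>t=1..n. F (t + k)) = (\<Sum>t=1+k..n+k. F t)"
    by (rule sum.shift_bounds_cl_nat_ivl[symmetric])
  also have "\<dots> \<le> (\<Sum>t=1..n+k. F t)"
    using F n by (intro sum_mono2) auto
  also have "(\<Sum>t=1..n+k. F t) = (\<Sum>t=1..N. F t) + (\<Sum>t=N+1..n+k. F t)"
    using sum.ub_add_nat[of 1 N F "n + k - N"] n(3) by simp
  also have "(\<Sum>t=N+1..n+k. F t) \<le> fbar * real (n + k - N)"
    using sum_bounded_above[of "{N+1..n+k}" F fbar] F n by (auto simp: mult.commute)
  also have "(\<Sum>t=1..n. mu t \<bullet> \<rho>) \<le> (\<Sum>t=1..N. mu t \<bullet> \<rho>)"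
    using n N mu_inner_nonneg by (intro sum_mono2) auto
  also have "real n * L \<le> real T * L" using \<open>0 \<le> L\<close> n by (intro mult_right_mono) auto
  finally have A: "(\<Sum>t=1..T - k. if unconstrained T \<rho> bbar b t
        then opt_reward (\<gamma> (t + k)) (mu t) + mu t \<bullet> \<rho> - c else 0)
      \<le> (\<Sum>t=1..N. F t) + fbar * real (n + k - N) + real T * L + (\<Sum>t=1..N. mu t \<bullet> \<rho>) - real n * c"
    by simp

  \<comment> \<open>The iterate is now paired with the request of its own period, so the price terms
    cancel and the reward of an accepted decision remains.\<close>
  have "(\<Sum>t=1..N. F t) + (\<Sum>t=1..N. mu t \<bullet> \<rho>) - (\<Sum>t=1..N. (\<rho> - b t) \<bullet> mu t)
      = (\<Sum>t=1..N. reward (\<gamma> t) (x t))"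
    unfolding sum.distrib[symmetric] sum_subtractf[symmetric]
  proof (rule sum.cong)
    fix t assume "t \<in> {1..N}"
    then have t: "t \<in> {1..T}" "t \<le> N" using N(1) by auto
    then show "F t + mu t \<bullet> \<rho> - (\<rho> - b t) \<bullet> mu t = reward (\<gamma> t) (x t)"
      using decision_unconstrained[OF t(1)] N(2)[OF t(1)]
      by (simp add: F_def opt_reward_run inner_diff_right inner_commute[of _ "mu t"])
  qed simp
  also have "\<dots> \<le> (\<Sum>t=1..T. reward (\<gamma> t) (x t))"
    using N(1) request_bounds(1)[OF bounded requests \<gamma> x_feasible] by (intro sum_mono2) auto
  finally have B: "(\<Sum>t=1..N. F t) + (\<Sum>t=1..N. mu t \<bullet> \<rho>) - (\<Sum>t=1..N. (\<rho> - b t) \<bullet> mu t)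
      \<le> (\<Sum>t=1..T. reward (\<gamma> t) (x t))" .
  \<comment> \<open>At most \<open>fbar\<close> is charged for each of the \<open>T - n\<close>
    periods that only contribute \<open>c\<close> and for each of the \<open>n + k - N\<close> extra
    requests; the comparator credits \<open>T - N\<close>. The balance is exactly
    \<open>k\<close>.\<close>
  have "real T * c - real n * c = real (T - n) * c" using n by (simp add: of_nat_diff left_diff_distrib)
  also have "\<dots> \<le> real (T - n) * fbar" using c by (intro mult_left_mono) auto
  finally have "real T * c - real n * c + fbar * real (n + k - N) - fbar * real (T - N)
      \<le> fbar * (real (T - n) + real (n + k - N) - real (T - N))"
    by (simp add: algebra_simps)
  also have "real (T - n) + real (n + k - N) - real (T - N) = real k"
    using n N(1) by (simp add: of_nat_diff)
  finally show ?thesis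
    using A B stopped_regret[OF N] unfolding L_def by linarith
qed

end

section \<open>Lagged conditional distributions\<close>

text \<open>By the layer cake formula it suffices to compare the superlevel sets of \<open>\<phi>\<close>; the level
  sets at the multiples of \<open>F / n\<close> approximate \<open>\<phi>\<close> uniformly.\<close>

lemma integral_le_of_measure_le:
  fixes \<phi> :: "'a \<Rightarrow> real"
  assumes "finite_measure N1" "finite_measure N2" and sets: "sets N1 = sets M" "sets N2 = sets M"
    and le: "\<And>C. C \<in> sets M \<Longrightarrow> measure N1 C \<le> a * measure N2 C + \<epsilon>"
    and a: "0 \<le> a" and \<phi>: "\<phi> \<in> borel_measurable M"
    and bounds: "\<And>x. x \<in> space M \<Longrightarrow> 0 \<le> \<phi> x" "\<And>x. x \<in> space M \<Longrightarrow> \<phi> x \<le> F"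
    and F: "0 \<le> F"
  shows "integral\<^sup>L N1 \<phi> \<le> a * integral\<^sup>L N2 \<phi> + F * \<epsilon>"
proof -
  interpret N1: finite_measure N1 by fact
  interpret N2: finite_measure N2 by fact
  have sp: "space N1 = space M" "space N2 = space M" using sets by (auto dest!: sets_eq_imp_space_eq)
  have m: "\<phi> \<in> borel_measurable N1" "\<phi> \<in> borel_measurable N2"
    using \<phi> by (simp_all add: measurable_cong_sets[OF sets(1) refl] measurable_cong_sets[OF sets(2) refl])
  have int: "integrable N1 \<phi>" "integrable N2 \<phi>"
    using m bounds sp by (auto intro!: N1.integrable_const_bound[where B=F] N2.integrable_const_bound[where B=F])
  show ?thesis
  proof (cases "F = 0")
    case True
    then have "\<phi> x = 0" if "x \<in> space M" for x using bounds that by (simp add: order_antisym)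
    then have "integral\<^sup>L N1 \<phi> = 0" "integral\<^sup>L N2 \<phi> = 0"
      using sp by (auto intro!: integral_eq_zero_AE)
    then show ?thesis using True by simp
  next
    case False
    then have F: "0 < F" using F by simp
    have approx: "integral\<^sup>L N1 \<phi> \<le> (a * integral\<^sup>L N2 \<phi> + F * \<epsilon>) + F * measure N1 (space N1) / real (Suc n)" for n
    proof -
      define q where "q = F / real (Suc n)"
      have q: "0 < q" "q * real (Suc n) = F" using F by (auto simp: q_def)
      define A where "A i = {x \<in> space M. real i * q \<le> \<phi> x}" for i
      have A: "A i \<in> sets M" for i unfolding A_def using \<phi> by measurable
      \<comment> \<open>Counting the levels reached rounds \<open>\<phi>\<close> down to a multiple
        of \<open>q\<close>. Level \<open>0\<close> is omitted, as it would add \<open>q\<close>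
        everywhere.\<close>
      define \<psi> where "\<psi> x = q * (\<Sum>i=1..Suc n. indicator (A i) x :: real)" for x
      have \<psi>: "\<psi> x \<le> \<phi> x" "\<phi> x \<le> \<psi> x + q" if x: "x \<in> space M" for x
      proof -
        define r where "r = \<phi> x / q"
        have r: "0 \<le> r" "r \<le> real (Suc n)" "\<phi> x = q * r"
          using bounds[OF x] q by (auto simp: r_def field_simps)
        have "(\<Sum>i=1..Suc n. indicator (A i) x :: real) = (\<Sum>i=1..Suc n. if real i \<le> r then 1 else 0)"
          using x q by (intro sum.cong) (auto simp: A_def r_def indicator_def field_simps)
        also have "\<dots> = real (card {i\<in>{1..Suc n}. real i \<le> r})"
          by (simp only: sum.inter_filter[symmetric] finite_atLeastAtMost) simp
        also have "{i\<in>{1..Suc n}. real i \<le> r} = {1..nat \<lfloor>r\<rfloor>}"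
          using r by (auto simp: le_nat_floor) (linarith)+
        also have "real (card {1..nat \<lfloor>r\<rfloor>}) = of_int \<lfloor>r\<rfloor>" using r by simp
        finally have "\<psi> x = q * of_int \<lfloor>r\<rfloor>" by (simp add: \<psi>_def)
        moreover have "q * of_int \<lfloor>r\<rfloor> \<le> q * r" "q * r \<le> q * (of_int \<lfloor>r\<rfloor> + 1)"
          using q by (intro mult_left_mono; linarith)+
        ultimately show "\<psi> x \<le> \<phi> x" "\<phi> x \<le> \<psi> x + q" using r by (simp_all add: distrib_left)
      qed
      have int_ind: "integrable N1 (indicator (A i) :: _ \<Rightarrow> real)" "integrable N2 (indicator (A i) :: _ \<Rightarrow> real)" for i
        using A sets N1.emeasure_finite N2.emeasure_finite
        by (auto simp: less_top[symmetric])
      have int\<psi>: "integrable N1 \<psi>" "integrable N2 \<psi>"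
        unfolding \<psi>_def using int_ind by auto
      have eq: "integral\<^sup>L N1 \<psi> = q * (\<Sum>i=1..Suc n. measure N1 (A i))"
        "integral\<^sup>L N2 \<psi> = q * (\<Sum>i=1..Suc n. measure N2 (A i))"
        unfolding \<psi>_def using int_ind A sets sp
        by (auto simp: Int_absorb2 sets.sets_into_space simp del: sum.cl_ivl_Suc)
      have "integral\<^sup>L N1 \<phi> \<le> integral\<^sup>L N1 (\<lambda>x. \<psi> x + q)"
        using int int\<psi> \<psi> sp by (intro integral_mono) auto
      also have "\<dots> = q * (\<Sum>i=1..Suc n. measure N1 (A i)) + q * measure N1 (space N1)"
        using int\<psi> eq by simp
      finally have upper: "integral\<^sup>L N1 \<phi> \<le> \<dots>" .
      \<comment> \<open>Each of the \<open>Suc n\<close> levels has error \<open>\<epsilon>\<close>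
        and weight \<open>q\<close>, and \<open>q * Suc n = F\<close>: the total error does not
        depend on the mesh.\<close>
      have "(\<Sum>i=1..Suc n. measure N1 (A i)) \<le> (\<Sum>i=1..Suc n. a * measure N2 (A i) + \<epsilon>)"
        by (intro sum_mono le A)
      also have "\<dots> = a * (\<Sum>i=1..Suc n. measure N2 (A i)) + real (Suc n) * \<epsilon>"
        by (simp add: sum.distrib sum_distrib_left del: sum.cl_ivl_Suc)
      finally have "q * (\<Sum>i=1..Suc n. measure N1 (A i))
          \<le> q * (a * (\<Sum>i=1..Suc n. measure N2 (A i)) + real (Suc n) * \<epsilon>)"
        using q by (intro mult_left_mono) auto
      also have "\<dots> = a * integral\<^sup>L N2 \<psi> + F * \<epsilon>"
        unfolding eq(2) q(2)[symmetric] by (simp only: distrib_left mult_ac)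
      finally have middle: "q * (\<Sum>i=1..Suc n. measure N1 (A i)) \<le> a * integral\<^sup>L N2 \<psi> + F * \<epsilon>" .
      have "integral\<^sup>L N2 \<psi> \<le> integral\<^sup>L N2 \<phi>"
        using int int\<psi> \<psi> sp by (intro integral_mono) auto
      then have "a * integral\<^sup>L N2 \<psi> \<le> a * integral\<^sup>L N2 \<phi>" using a by (rule mult_left_mono)
      with upper middle show ?thesis by (simp add: q_def)
    qed
    have "(\<lambda>n. (a * integral\<^sup>L N2 \<phi> + F * \<epsilon>) + F * measure N1 (space N1) / real (Suc n))
        \<longlonglongrightarrow> (a * integral\<^sup>L N2 \<phi> + F * \<epsilon>) + 0"
      by (intro tendsto_add tendsto_const LIMSEQ_Suc lim_const_over_n)
    then show ?thesis using approx by (auto intro: LIMSEQ_le_const)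
  qed
qed

text \<open>Instantiated with \<open>s = t - 1\<close> and \<open>u = t + k\<close>: the request of
  period \<open>u\<close> against the history that determines the iterate of period
  \<open>t\<close>.\<close>

locale lagged_process = prob_space P
  for P :: "(nat \<Rightarrow> 'a) measure" +
  fixes M :: "'a measure" and T s u :: nat and K :: "(nat \<Rightarrow> 'a) \<Rightarrow> 'a measure" and Q :: "'a measure"
    and \<delta> :: real
  assumes sets_P: "sets P = sets (hist T M)"
    and times: "s \<le> T" "u \<in> {1..T}"
    and cond: "cond_distribution M P u s K"
    and Q: "prob_space Q" "sets Q = sets M"
    and tv: "\<And>\<gamma>. \<gamma> \<in> space (hist T M) \<Longrightarrow> tv_dist M (K (restrict \<gamma> {1..s})) Q \<le> ennreal \<delta>"
    and \<delta>: "0 \<le> \<delta>"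
begin

lemma space_P: "space P = space (hist T M)"
  using sets_P by (rule sets_eq_imp_space_eq)

lemma measurable_P: "f \<in> measurable P N \<longleftrightarrow> f \<in> measurable (hist T M) N"
  by (simp add: measurable_cong_sets[OF sets_P refl])

lemma measurable_past [measurable]: "(\<lambda>\<gamma>. restrict \<gamma> {1..s}) \<in> measurable P (hist s M)"
  unfolding measurable_P using times by (intro measurable_restrict_subset) auto

lemma measurable_component [measurable]: "(\<lambda>\<gamma>. \<gamma> u) \<in> measurable P M"
  unfolding measurable_P using times by (intro measurable_component_singleton) auto

abbreviation past :: "(nat \<Rightarrow> 'a) set \<Rightarrow> (nat \<Rightarrow> 'a) set" where
  "past A \<equiv> {\<gamma> \<in> space P. restrict \<gamma> {1..s} \<in> A}"

lemma past_sets: "A \<in> sets (hist s M) \<Longrightarrow> past A \<in> sets P"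
  using measurable_sets[OF measurable_past, of A] by (simp add: vimage_def Int_def conj_commute)

text \<open>Integrate the pointwise bound on the kernel over the past event. The error carries the
  probability of that event, so that errors over disjoint past events add up to at most
  \<open>\<delta>\<close>.\<close>

lemma measure_past_le:
  assumes A: "A \<in> sets (hist s M)" and C: "C \<in> sets M"
  shows "measure P {\<gamma> \<in> space P. restrict \<gamma> {1..s} \<in> A \<and> \<gamma> u \<in> C}
    \<le> measure P (past A) * measure Q C + measure P (past A) * \<delta>"
proof -
  interpret Q: prob_space Q by (rule Q)
  have K: "emeasure (K (restrict \<gamma> {1..s})) C \<le> ennreal (measure Q C + \<delta>)"
    if "\<gamma> \<in> space P" for \<gamma>
  proof -
    let ?K = "K (restrict \<gamma> {1..s})"
    have "K \<in> measurable (hist s M) (prob_algebra M)"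
      using cond by (simp add: cond_distribution_def)
    from measurable_space[OF this measurable_space[OF measurable_past that]]
    have "?K \<in> space (prob_algebra M)" .
    then interpret K: prob_space ?K by (simp add: space_prob_algebra)
    have "ennreal \<bar>measure ?K C - measure Q C\<bar> \<le> tv_dist M ?K Q"
      unfolding tv_dist_def using C by (intro SUP_upper)
    also have "\<dots> \<le> ennreal \<delta>" using tv that space_P by simp
    finally have "\<bar>measure ?K C - measure Q C\<bar> \<le> \<delta>" using \<delta> by simp
    then show ?thesis unfolding K.emeasure_eq_measure by (intro ennreal_leI) linarith
  qed
  have "emeasure P {\<gamma> \<in> space P. restrict \<gamma> {1..s} \<in> A \<and> \<gamma> u \<in> C}
      = (\<integral>\<^sup>+ \<gamma>. indicator A (restrict \<gamma> {1..s}) * emeasure (K (restrict \<gamma> {1..s})) C \<partial>P)"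
    using cond A C unfolding cond_distribution_def by blast
  also have "\<dots> \<le> (\<integral>\<^sup>+ \<gamma>. ennreal (measure Q C + \<delta>) * indicator (past A) \<gamma> \<partial>P)"
    using K by (intro nn_integral_mono) (auto simp: indicator_def)
  also have "\<dots> = ennreal ((measure Q C + \<delta>) * measure P (past A))"
    using past_sets[OF A] \<delta>
    by (simp add: nn_integral_cmult_indicator emeasure_eq_measure ennreal_mult')
  finally have "ennreal (measure P {\<gamma> \<in> space P. restrict \<gamma> {1..s} \<in> A \<and> \<gamma> u \<in> C})
      \<le> ennreal ((measure Q C + \<delta>) * measure P (past A))"
    unfolding emeasure_eq_measure .
  then show ?thesis
    using \<delta> by (subst (asm) ennreal_le_iff) (auto simp: algebra_simps)
qed

text \<open>The law of the request on a past event is a finite measure of mass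
  \<open>measure P (past A)\<close>; it is compared with \<open>Q\<close> scaled by that
  mass.\<close>

lemma integral_past_le:
  fixes \<phi> :: "'a \<Rightarrow> real"
  assumes A: "A \<in> sets (hist s M)" and \<phi>: "\<phi> \<in> borel_measurable M"
    and bounds: "\<And>x. x \<in> space M \<Longrightarrow> 0 \<le> \<phi> x" "\<And>x. x \<in> space M \<Longrightarrow> \<phi> x \<le> F" and F: "0 \<le> F"
  shows "(\<integral>\<gamma>. indicator A (restrict \<gamma> {1..s}) * \<phi> (\<gamma> u) \<partial>P)
    \<le> measure P (past A) * integral\<^sup>L Q \<phi> + F * (measure P (past A) * \<delta>)"
proof -
  let ?R = "restrict_space P (past A)"
  let ?N = "distr ?R M (\<lambda>\<gamma>. \<gamma> u)"
  have pA: "past A \<in> sets P" by (rule past_sets[OF A])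
  then have pA': "past A \<inter> space P \<in> sets P" by auto
  have mu: "(\<lambda>\<gamma>. \<gamma> u) \<in> measurable ?R M" by (intro measurable_restrict_space1 measurable_component)
  interpret Q: prob_space Q by (rule Q)
  have "finite_measure ?R" using pA by (intro finite_measure_restrict_space) auto
  then have fin: "finite_measure ?N" by (rule finite_measure.finite_measure_distr[OF _ mu])
  have "(\<integral>\<gamma>. indicator A (restrict \<gamma> {1..s}) * \<phi> (\<gamma> u) \<partial>P)
      = (\<integral>\<gamma>. indicator (past A) \<gamma> *\<^sub>R \<phi> (\<gamma> u) \<partial>P)"
    by (intro Bochner_Integration.integral_cong) (auto simp: indicator_def)
  also have "\<dots> = integral\<^sup>L ?R (\<lambda>\<gamma>. \<phi> (\<gamma> u))"
    by (rule integral_restrict_space[OF pA', symmetric])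
  also have "\<dots> = integral\<^sup>L ?N \<phi>"
    by (rule integral_distr[OF mu \<phi>, symmetric])
  also have "\<dots> \<le> measure P (past A) * integral\<^sup>L Q \<phi> + F * (measure P (past A) * \<delta>)"
  proof (rule integral_le_of_measure_le[OF fin Q.finite_measure_axioms _ Q(2) _ _ \<phi> bounds F])
    fix C assume C: "C \<in> sets M"
    have "measure ?N C = measure ?R ((\<lambda>\<gamma>. \<gamma> u) -` C \<inter> space ?R)"
      by (rule measure_distr[OF mu C])
    also have "\<dots> = measure P ((\<lambda>\<gamma>. \<gamma> u) -` C \<inter> space ?R)"
      using pA by (intro measure_restrict_space) (auto simp: space_restrict_space)
    also have "(\<lambda>\<gamma>. \<gamma> u) -` C \<inter> space ?R = {\<gamma> \<in> space P. restrict \<gamma> {1..s} \<in> A \<and> \<gamma> u \<in> C}"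
      by (auto simp: space_restrict_space)
    also have "measure P \<dots> \<le> measure P (past A) * measure Q C + measure P (past A) * \<delta>"
      by (rule measure_past_le[OF A C])
    finally show "measure ?N C \<le> measure P (past A) * measure Q C + measure P (past A) * \<delta>" .
  qed auto
  finally show ?thesis .
qed

lemma integrable_past:
  fixes \<phi> :: "'a \<Rightarrow> real"
  assumes A: "A \<in> sets (hist s M)" and \<phi> [measurable]: "\<phi> \<in> borel_measurable M"
    and bounds: "\<And>x. x \<in> space M \<Longrightarrow> 0 \<le> \<phi> x" "\<And>x. x \<in> space M \<Longrightarrow> \<phi> x \<le> F" and F: "0 \<le> F"
  shows "integrable P (\<lambda>\<gamma>. indicator A (restrict \<gamma> {1..s}) * \<phi> (\<gamma> u))"
proof (rule integrable_const_bound[where B=F])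
  note [measurable] = A
  show "(\<lambda>\<gamma>. indicator A (restrict \<gamma> {1..s}) * \<phi> (\<gamma> u)) \<in> borel_measurable P" by measurable
  show "AE \<gamma> in P. norm (indicator A (restrict \<gamma> {1..s}) * \<phi> (\<gamma> u)) \<le> F"
    using bounds F measurable_space[OF measurable_component] by (auto simp: indicator_def)
qed

text \<open>The upper bound applied to \<open>F - \<phi>\<close>, which has the same range
  \<open>[0, F]\<close> and hence the same error.\<close>

lemma integral_past_ge:
  fixes \<phi> :: "'a \<Rightarrow> real"
  assumes A: "A \<in> sets (hist s M)" and \<phi>: "\<phi> \<in> borel_measurable M"
    and bounds: "\<And>x. x \<in> space M \<Longrightarrow> 0 \<le> \<phi> x" "\<And>x. x \<in> space M \<Longrightarrow> \<phi> x \<le> F" and F: "0 \<le> F"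
  shows "measure P (past A) * (integral\<^sup>L Q \<phi> - F * \<delta>)
    \<le> (\<integral>\<gamma>. indicator A (restrict \<gamma> {1..s}) * \<phi> (\<gamma> u) \<partial>P)"
proof -
  interpret Q: prob_space Q by (rule Q)
  have intQ: "integrable Q \<phi>"
    using bounds \<phi> sets_eq_imp_space_eq[OF Q(2)]
    by (intro Q.integrable_const_bound[where B=F]) (auto simp: measurable_cong_sets[OF Q(2) refl])
  have ind: "(\<integral>\<gamma>. indicator A (restrict \<gamma> {1..s}) \<partial>P) = measure P (past A)"
  proof -
    have "(\<integral>\<gamma>. indicator A (restrict \<gamma> {1..s}) \<partial>P) = (\<integral>\<gamma>. indicator (past A) \<gamma> \<partial>P :: real)"
      by (intro Bochner_Integration.integral_cong) (auto simp: indicator_def)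
    then show ?thesis using past_sets[OF A] by (simp add: Int_absorb2 sets.sets_into_space)
  qed
  have "(\<integral>\<gamma>. indicator A (restrict \<gamma> {1..s}) * (F - \<phi> (\<gamma> u)) \<partial>P)
      \<le> measure P (past A) * integral\<^sup>L Q (\<lambda>x. F - \<phi> x) + F * (measure P (past A) * \<delta>)"
    using bounds \<phi> F by (intro integral_past_le[OF A]) auto
  also have "integral\<^sup>L Q (\<lambda>x. F - \<phi> x) = F - integral\<^sup>L Q \<phi>"
    using intQ by (simp add: Q.prob_space)
  also have "(\<integral>\<gamma>. indicator A (restrict \<gamma> {1..s}) * (F - \<phi> (\<gamma> u)) \<partial>P)
      = (\<integral>\<gamma>. indicator A (restrict \<gamma> {1..s}) * F - indicator A (restrict \<gamma> {1..s}) * \<phi> (\<gamma> u) \<partial>P)"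
    by (simp add: right_diff_distrib)
  also have "\<dots> = (\<integral>\<gamma>. indicator A (restrict \<gamma> {1..s}) * F \<partial>P)
      - (\<integral>\<gamma>. indicator A (restrict \<gamma> {1..s}) * \<phi> (\<gamma> u) \<partial>P)"
    using integrable_past[OF A, of "\<lambda>_. F" F] integrable_past[OF A \<phi> bounds F] F
    by (intro Bochner_Integration.integral_diff) auto
  also have "(\<integral>\<gamma>. indicator A (restrict \<gamma> {1..s}) * F \<partial>P) = measure P (past A) * F"
    unfolding ind[symmetric] by (rule integral_mult_left_zero)
  finally have "measure P (past A) * F - (\<integral>\<gamma>. indicator A (restrict \<gamma> {1..s}) * \<phi> (\<gamma> u) \<partial>P)
      \<le> measure P (past A) * (F - integral\<^sup>L Q \<phi>) + F * (measure P (past A) * \<delta>)" .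
  moreover have "p * (I - F * \<delta>) \<le> J" if "p * F - J \<le> p * (F - I) + F * (p * \<delta>)" for p I J :: real
    using that by (simp add: algebra_simps)
  ultimately show ?thesis by blast
qed

end

section \<open>Multipliers that depend on the past\<close>

definition nonneg_part :: "real ^ 'n \<Rightarrow> real ^ 'n" where
  "nonneg_part v = (\<chi> j. max 0 (v $ j))"

lemma nonneg_part_nonneg: "0 \<le> nonneg_part v"
  by (simp add: nonneg_part_def less_eq_vec_def)

lemma nonneg_part_eq: "0 \<le> v \<Longrightarrow> nonneg_part v = v"
  by (simp add: nonneg_part_def less_eq_vec_def vec_eq_iff max_def)

lemma norm_nonneg_part_le: "norm (nonneg_part v) \<le> norm v"
  by (rule norm_le_componentwise_cart) (auto simp: nonneg_part_def)

lemma tendsto_nonneg_part: "(f \<longlongrightarrow> l) F \<Longrightarrow> ((\<lambda>x. nonneg_part (f x)) \<longlongrightarrow> nonneg_part l) F"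
  unfolding nonneg_part_def by (intro tendsto_intros) auto

context lagged_process begin

text \<open>The multiplier \<open>m\<close> is a function of the past; approximating it by simple functions reduces
  the claim to constant multipliers, for which the lagged request is compared with \<open>Q\<close>.\<close>

lemma lagged_dual_bound:
  fixes f :: "'a \<Rightarrow> real ^ 'n \<Rightarrow> real" and m :: "(nat \<Rightarrow> 'a) \<Rightarrow> real ^ 'n"
  assumes A: "A \<in> sets (hist s M)" and m: "m \<in> borel_measurable (hist s M)"
    and m_nonneg: "\<And>\<omega>. \<omega> \<in> space (hist s M) \<Longrightarrow> 0 \<le> m \<omega>"
    and m_bound: "\<And>\<omega>. \<omega> \<in> space (hist s M) \<Longrightarrow> norm (m \<omega>) \<le> Bm"
    and f: "\<And>\<mu>. 0 \<le> \<mu> \<Longrightarrow> (\<lambda>g. f g \<mu>) \<in> borel_measurable M"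
    and bounds: "\<And>g \<mu>. g \<in> space M \<Longrightarrow> 0 \<le> \<mu> \<Longrightarrow> 0 \<le> f g \<mu>"
      "\<And>g \<mu>. g \<in> space M \<Longrightarrow> 0 \<le> \<mu> \<Longrightarrow> f g \<mu> \<le> F" and F: "0 \<le> F"
    and cont: "\<And>g. g \<in> space M \<Longrightarrow> continuous_on {0..} (f g)"
    and c: "\<And>\<mu>. 0 \<le> \<mu> \<Longrightarrow> c \<le> integral\<^sup>L Q (\<lambda>g. f g \<mu>) + \<mu> \<bullet> \<rho>"
  defines "X \<equiv> \<lambda>m \<gamma>. indicator A (restrict \<gamma> {1..s}) *
      (f (\<gamma> u) (m (restrict \<gamma> {1..s})) + m (restrict \<gamma> {1..s}) \<bullet> \<rho> - c)"
  shows "integrable P (X m)" and "- F * \<delta> \<le> integral\<^sup>L P (X m)"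
proof -
  have simple: "X m' \<in> borel_measurable P \<and> integrable P (X m') \<and> - F * \<delta> \<le> integral\<^sup>L P (X m')"
    if m': "simple_function (hist s M) m'" and nn: "\<And>\<omega>. 0 \<le> m' \<omega>" for m'
  proof -
    define V where "V = m' ` space (hist s M)"
    have V: "finite V" using m' by (simp add: V_def simple_function_def)
    \<comment> \<open>On the past event \<open>A' v\<close> the multiplier is the constant
      \<open>v\<close>, to which the comparison with \<open>Q\<close> applies.\<close>
    define A' where "A' v = A \<inter> (m' -` {v} \<inter> space (hist s M))" for v
    have A': "A' v \<in> sets (hist s M)" for v
      unfolding A'_def using A simple_functionD(2)[OF m'] by auto
    define Y where "Y v \<gamma> = indicator (A' v) (restrict \<gamma> {1..s}) * f (\<gamma> u) v
        + (v \<bullet> \<rho> - c) * indicator (past (A' v)) \<gamma>" for v \<gamma>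
    have X_eq: "X m' \<gamma> = (\<Sum>v\<in>V. Y v \<gamma>)" if "\<gamma> \<in> space P" for \<gamma>
    proof -
      let ?\<omega> = "restrict \<gamma> {1..s}"
      have \<omega>: "?\<omega> \<in> space (hist s M)" using measurable_space[OF measurable_past that] .
      have "(\<Sum>v\<in>V. Y v \<gamma>) = (\<Sum>v\<in>V. if v = m' ?\<omega> then X m' \<gamma> else 0)"
        using \<omega> that by (intro sum.cong) (auto simp: Y_def X_def A'_def indicator_def)
      also have "\<dots> = X m' \<gamma>" using V \<omega> by (simp add: V_def)
      finally show ?thesis by simp
    qed
    have vn: "0 \<le> v" if "v \<in> V" for v using that nn by (auto simp: V_def)
    have int_f: "integrable P (\<lambda>\<gamma>. indicator (A' v) (restrict \<gamma> {1..s}) * f (\<gamma> u) v)" if "v \<in> V" for v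
      by (rule integrable_past[OF A' f[OF vn[OF that]] _ _ F]) (use bounds vn[OF that] in auto)
    have int_ind: "integrable P (\<lambda>\<gamma>. (v \<bullet> \<rho> - c) * indicator (past (A' v)) \<gamma>)" for v
      using past_sets[OF A'] by (intro integrable_mult_right) (auto simp: less_top[symmetric])
    have intY: "integrable P (Y v)" if "v \<in> V" for v
      unfolding Y_def using int_f[OF that] int_ind by (rule Bochner_Integration.integrable_add)
    have int: "integrable P (X m')"
      using Bochner_Integration.integrable_sum[of V P Y] intY
      by (subst Bochner_Integration.integrable_cong[OF refl X_eq]) auto
    have Y_ge: "- F * \<delta> * measure P (past (A' v)) \<le> integral\<^sup>L P (Y v)" if v: "v \<in> V" for v
    proof -
      have "integral\<^sup>L P (Y v) = (\<integral>\<gamma>. indicator (A' v) (restrict \<gamma> {1..s}) * f (\<gamma> u) v \<partial>P)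
          + (v \<bullet> \<rho> - c) * measure P (past (A' v))"
        unfolding Y_def Bochner_Integration.integral_add[OF int_f[OF v] int_ind]
        using past_sets[OF A'] by (simp add: Int_absorb2 sets.sets_into_space)
      moreover have "measure P (past (A' v)) * (integral\<^sup>L Q (\<lambda>g. f g v) - F * \<delta>)
          \<le> (\<integral>\<gamma>. indicator (A' v) (restrict \<gamma> {1..s}) * f (\<gamma> u) v \<partial>P)"
        by (rule integral_past_ge[OF A' f[OF vn[OF v]] _ _ F]) (use bounds vn[OF v] in auto)
      moreover have "0 \<le> measure P (past (A' v)) * (integral\<^sup>L Q (\<lambda>g. f g v) + v \<bullet> \<rho> - c)"
        using c[OF vn[OF v]] by simp
      ultimately show ?thesis by (simp add: algebra_simps)
    qed
    \<comment> \<open>Disjointness keeps the sum of the errors below \<open>F * \<delta>\<close>,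
      however many values the multiplier takes.\<close>
    have "(\<Sum>v\<in>V. measure P (past (A' v))) = measure P (\<Union>v\<in>V. past (A' v))"
      using V past_sets[OF A'] by (intro finite_measure_finite_Union[symmetric])
        (auto simp: disjoint_family_on_def A'_def)
    also have "\<dots> \<le> 1" by simp
    finally have "F * \<delta> * (\<Sum>v\<in>V. measure P (past (A' v))) \<le> F * \<delta> * 1"
      using F \<delta> by (intro mult_left_mono) auto
    then have "- F * \<delta> \<le> (\<Sum>v\<in>V. - F * \<delta> * measure P (past (A' v)))"
      by (simp add: sum_distrib_left sum_negf)
    also have "\<dots> \<le> (\<Sum>v\<in>V. integral\<^sup>L P (Y v))" by (intro sum_mono Y_ge)
    also have "\<dots> = integral\<^sup>L P (X m')"
      using intY X_eq by (subst Bochner_Integration.integral_cong[OF refl X_eq]) auto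
    finally show ?thesis using int by (simp add: borel_measurable_integrable)
  qed
  from borel_measurable_implies_sequence_metric[OF m, of 0]
  obtain m0 where *: "\<forall>i. simple_function (hist s M) (m0 i)"
    "\<forall>\<omega>\<in>space (hist s M). (\<lambda>i. m0 i \<omega>) \<longlonglongrightarrow> m \<omega>"
    "\<forall>i. \<forall>\<omega>\<in>space (hist s M). dist (m0 i \<omega>) 0 \<le> 2 * dist (m \<omega>) 0"
    by (elim exE conjE)
  note m0 = *(1)[THEN spec] *(2)[THEN bspec] *(3)[THEN spec, THEN bspec]
  \<comment> \<open>Clipping keeps the approximants in the orthant, where \<open>f\<close> is
    controlled. It fixes the limit, which is nonnegative, and does not increase norms.\<close>
  define m1 where "m1 i = (\<lambda>\<omega>. nonneg_part (m0 i \<omega>))" for i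
  have m1: "simple_function (hist s M) (m1 i)" "0 \<le> m1 i \<omega>" for i \<omega>
    unfolding m1_def using simple_function_compose1[OF m0(1)] nonneg_part_nonneg by auto
  have m1_lim: "(\<lambda>i. m1 i \<omega>) \<longlonglongrightarrow> m \<omega>" if "\<omega> \<in> space (hist s M)" for \<omega>
    using tendsto_nonneg_part[OF m0(2)[OF that]] nonneg_part_eq[OF m_nonneg[OF that]]
    by (simp add: m1_def)
  have m1_bound: "norm (m1 i \<omega>) \<le> 2 * Bm" if "\<omega> \<in> space (hist s M)" for i \<omega>
    using norm_nonneg_part_le[of "m0 i \<omega>"] m0(3)[OF that, of i] m_bound[OF that] by (simp add: m1_def)
  have X_lim: "(\<lambda>i. X (m1 i) \<gamma>) \<longlonglongrightarrow> X m \<gamma>" if "\<gamma> \<in> space P" for \<gamma>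
  proof -
    let ?\<omega> = "restrict \<gamma> {1..s}"
    have \<omega>: "?\<omega> \<in> space (hist s M)" using measurable_space[OF measurable_past that] .
    have g: "\<gamma> u \<in> space M" using measurable_space[OF measurable_component that] .
    have "(\<lambda>i. f (\<gamma> u) (m1 i ?\<omega>)) \<longlonglongrightarrow> f (\<gamma> u) (m ?\<omega>)"
      using continuous_on_tendsto_compose[OF cont[OF g] m1_lim[OF \<omega>]] m_nonneg[OF \<omega>] m1(2) by simp
    then show ?thesis
      unfolding X_def by (intro tendsto_intros m1_lim[OF \<omega>])
  qed
  have sm: "X (m1 i) \<in> borel_measurable P" "- F * \<delta> \<le> integral\<^sup>L P (X (m1 i))" for i
    using simple[OF m1] by blast+
  have X_meas: "X m \<in> borel_measurable P"
    by (rule borel_measurable_LIMSEQ_metric[OF sm(1) X_lim])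
  \<comment> \<open>A dominating constant; the factor 2 comes from the norm bound on the
    approximating sequence.\<close>
  let ?C = "F + 2 * Bm * norm \<rho> + \<bar>c\<bar>"
  have X_bound: "norm (X (m1 i) \<gamma>) \<le> ?C" if "\<gamma> \<in> space P" for i \<gamma>
  proof -
    let ?\<omega> = "restrict \<gamma> {1..s}"
    have \<omega>: "?\<omega> \<in> space (hist s M)" using measurable_space[OF measurable_past that] .
    have g: "\<gamma> u \<in> space M" using measurable_space[OF measurable_component that] .
    have "\<bar>m1 i ?\<omega> \<bullet> \<rho>\<bar> \<le> norm (m1 i ?\<omega>) * norm \<rho>" by (rule Cauchy_Schwarz_ineq2)
    also have "\<dots> \<le> 2 * Bm * norm \<rho>" using m1_bound[OF \<omega>] by (intro mult_right_mono) auto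
    finally show ?thesis
      using bounds[OF g m1(2)[of i ?\<omega>]] F by (auto simp: X_def indicator_def)
  qed
  have dom: "AE \<gamma> in P. (\<lambda>i. X (m1 i) \<gamma>) \<longlonglongrightarrow> X m \<gamma>" "\<And>i. AE \<gamma> in P. norm (X (m1 i) \<gamma>) \<le> ?C"
    by (rule AE_I2, erule X_lim X_bound)+
  show "integrable P (X m)"
    by (rule integrable_dominated_convergence[OF X_meas sm(1) _ dom]) simp
  have "(\<lambda>i. integral\<^sup>L P (X (m1 i))) \<longlonglongrightarrow> integral\<^sup>L P (X m)"
    by (rule integral_dominated_convergence[OF X_meas sm(1) _ dom]) simp
  then show "- F * \<delta> \<le> integral\<^sup>L P (X m)"
    by (rule LIMSEQ_le_const) (use sm(2) in blast)
qed

end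

section \<open>Measurability of the dual iterates\<close>

text \<open>Membership of \<open>m x\<close> in an open set is a countable condition: some candidate
  whose small ball lies in the set is nearly optimal among all candidates. Growth places
  near-optimal candidates close to \<open>m x\<close>, and \<open>approx\<close> identifies the
  infimum over \<open>Q\<close> with the minimum.\<close>

lemma borel_measurable_minimizer:
  fixes m :: "'a \<Rightarrow> 'b::metric_space" and F :: "'a \<Rightarrow> 'b \<Rightarrow> real"
  assumes Q: "countable Q" and F: "\<And>q. q \<in> Q \<Longrightarrow> (\<lambda>x. F x q) \<in> borel_measurable N"
    and growth: "\<And>x q. x \<in> space N \<Longrightarrow> q \<in> Q \<Longrightarrow> F x (m x) + c * (dist q (m x))\<^sup>2 \<le> F x q"
    and c: "0 < c"
    and approx: "\<And>x e. x \<in> space N \<Longrightarrow> 0 < e \<Longrightarrow> \<exists>q\<in>Q. F x q < F x (m x) + e"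
  shows "m \<in> borel_measurable N"
proof (rule borel_measurableI)
  fix S :: "'b set" assume "open S"
  \<comment> \<open>The tolerance that forces distance below \<open>1 / Suc n\<close>; halving makes
    the inequality strict.\<close>
  define e where "e n = c * (1 / real (Suc n))\<^sup>2 / 2" for n
  have e: "0 < e n" for n using c by (simp add: e_def)
  have close: "dist q (m x) < 1 / real (Suc n)"
    if "x \<in> space N" "q \<in> Q" "F x q \<le> F x (m x) + e n" for x q n
  proof -
    have "c * (dist q (m x))\<^sup>2 \<le> c * ((1 / real (Suc n))\<^sup>2 / 2)"
      using growth[OF that(1,2)] that(3) by (simp add: e_def)
    then have "(dist q (m x))\<^sup>2 \<le> (1 / real (Suc n))\<^sup>2 / 2" using c by simp
    also have "\<dots> < (1 / real (Suc n))\<^sup>2" by simp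
    finally show ?thesis by (rule power2_less_imp_less) simp
  qed
  define J where "J = {(q, n). q \<in> Q \<and> ball q (1 / real (Suc n)) \<subseteq> S}"
  have J: "countable J"
    by (rule countable_subset[of _ "Q \<times> (UNIV :: nat set)"]) (use Q in \<open>auto simp: J_def\<close>)
  have "m -` S \<inter> space N
      = {x \<in> space N. \<exists>(q, n)\<in>J. \<forall>q'\<in>Q. F x q \<le> F x q' + e n}" (is "?L = ?R")
  proof (intro equalityI subsetI)
    fix x assume x: "x \<in> ?R"
    then obtain q n where q: "q \<in> Q" "ball q (1 / real (Suc n)) \<subseteq> S" "\<And>q'. q' \<in> Q \<Longrightarrow> F x q \<le> F x q' + e n"
      by (auto simp: J_def)
    have "F x q \<le> F x (m x) + e n"
    proof (rule field_le_epsilon)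
      fix d :: real assume "0 < d"
      with approx[of x d] x obtain q' where "q' \<in> Q" "F x q' < F x (m x) + d" by auto
      then show "F x q \<le> F x (m x) + e n + d" using q(3)[of q'] by simp
    qed
    then show "x \<in> ?L" using close q x by (auto simp: subset_iff)
  next
    fix x assume x: "x \<in> ?L"
    then obtain r where r: "0 < r" "ball (m x) r \<subseteq> S"
      using \<open>open S\<close> by (auto simp: open_contains_ball)
    from reals_Archimedean[of "r / 2"] r obtain n where "inverse (real (Suc n)) < r / 2" by auto
    then have n: "2 / real (Suc n) < r" by (simp add: field_simps)
    from approx[of x "e n"] x e obtain q where q: "q \<in> Q" "F x q < F x (m x) + e n" by auto
    have d: "dist q (m x) < 1 / real (Suc n)" using close q x by auto
    have "ball q (1 / real (Suc n)) \<subseteq> ball (m x) r"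
    proof
      fix v assume "v \<in> ball q (1 / real (Suc n))"
      then have "dist (m x) v < 1 / real (Suc n) + 1 / real (Suc n)"
        using d by (intro dist_triangle_less_add[of "m x" q]) (auto simp: dist_commute)
      then show "v \<in> ball (m x) r" using n by simp
    qed
    then have "(q, n) \<in> J" using q r by (auto simp: J_def)
    moreover have "F x q \<le> F x q' + e n" if "q' \<in> Q" for q'
    proof -
      have "0 \<le> c * (dist q' (m x))\<^sup>2" using c by simp
      then show ?thesis using growth[of x q'] that x q(2) by auto
    qed
    ultimately show "x \<in> ?R" using x by blast
  qed
  also have "\<dots> \<in> sets N"
  proof (rule sets.sets_Collect_countable_Ex'[OF _ J], clarify)
    fix q n assume "(q, n) \<in> J"
    then have "q \<in> Q" by (simp add: J_def)
    show "{x \<in> space N. \<forall>q'\<in>Q. F x q \<le> F x q' + e n} \<in> sets N"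
      by (rule sets.sets_Collect_countable_All'[OF _ Q])
        (use F \<open>q \<in> Q\<close> in \<open>auto intro!: borel_measurable_le\<close>)
  qed
  finally show "m -` S \<inter> space N \<in> sets N" .
qed

context mirror_map begin

lemma h_continuous_on_U: "continuous_on U h"
  unfolding continuous_on_eq_continuous_within
proof
  fix y assume "y \<in> U"
  then have "continuous (at y within {0..}) h"
    using U_differentiable differentiable_imp_continuous_within by blast
  then show "continuous (at y within U) h"
    using U_nonneg by (auto intro: continuous_within_subset)
qed

lemma borel_measurable_h:
  assumes "w \<in> borel_measurable N" "\<And>x. x \<in> space N \<Longrightarrow> w x \<in> U"
  shows "(\<lambda>x. h (w x)) \<in> borel_measurable N"
proof -
  have "(\<lambda>y. indicator U y *\<^sub>R h y) \<in> borel_measurable borel"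
    using U_borel h_continuous_on_U by (rule borel_measurable_continuous_on_indicator)
  from measurable_compose[OF assms(1) this]
  have "(\<lambda>x. indicator U (w x) *\<^sub>R h (w x)) \<in> borel_measurable N" .
  then show ?thesis
    by (rule measurable_cong[THEN iffD1, rotated]) (use assms(2) in simp)
qed

text \<open>The derivative is a choice that varies with the base point, so measurability comes from
  writing its directional value as a limit of measurable difference quotients.\<close>

lemma borel_measurable_bregman:
  assumes w: "w \<in> borel_measurable N" and U: "\<And>x. x \<in> space N \<Longrightarrow> w x \<in> U" and \<nu>: "0 \<le> \<nu>"
  shows "(\<lambda>x. bregman h \<nu> (w x)) \<in> borel_measurable N"
proof -
  \<comment> \<open>The index is shifted by two so that all step lengths are below \<open>1\<close>,
    which keeps the points in \<open>U\<close>.\<close>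
  define r :: "nat \<Rightarrow> real" where "r n = 1 / real (Suc (Suc n))" for n
  have r: "0 < r n" "r n < 1" "r n \<noteq> 0" for n by (auto simp: r_def)
  have "r \<longlonglongrightarrow> 0"
    unfolding r_def by (intro LIMSEQ_Suc lim_const_over_n)
  then have r_lim: "filterlim r (at_right 0) sequentially"
    using r by (auto simp: filterlim_at intro!: always_eventually)
  define q where "q n x = (h (w x + r n *\<^sub>R (\<nu> - w x)) - h (w x)) / r n" for n x
  have q: "q n \<in> borel_measurable N" for n
  proof -
    have "(\<lambda>x. h (w x + r n *\<^sub>R (\<nu> - w x))) \<in> borel_measurable N"
      using w by (intro borel_measurable_h borel_measurable_add borel_measurable_scaleR
          borel_measurable_diff U_segment U \<nu>) (use r in \<open>auto intro: less_imp_le\<close>)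
    then show ?thesis unfolding q_def using borel_measurable_h[OF w U] by simp
  qed
  have "(\<lambda>n. q n x) \<longlonglongrightarrow> frechet_derivative h (at (w x) within {0..}) (\<nu> - w x)"
    if "x \<in> space N" for x
  proof -
    have "(h has_derivative frechet_derivative h (at (w x) within {0..})) (at (w x) within {0..})"
      using U_differentiable[OF U[OF that]] frechet_derivative_works by blast
    from has_derivative_quotient_at_right[OF this convex_orthant, of \<nu>] \<nu> U_nonneg[OF U[OF that]]
    have "((\<lambda>u. (h (w x + u *\<^sub>R (\<nu> - w x)) - h (w x)) / u) \<longlongrightarrow>
        frechet_derivative h (at (w x) within {0..}) (\<nu> - w x)) (at_right 0)" by simp
    from filterlim_compose[OF this r_lim] show ?thesis by (simp add: q_def)
  qed
  with q have "(\<lambda>x. frechet_derivative h (at (w x) within {0..}) (\<nu> - w x)) \<in> borel_measurable N"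
    by (rule borel_measurable_LIMSEQ_metric)
  then show ?thesis
    unfolding bregman_def using borel_measurable_h[OF w U] by simp
qed

text \<open>The candidates are a countable dense subset of the orthant, and the growth constant is
  that of \<open>mirror_step_growth\<close>. Measurability of the divergence is a premise, because
  the first base point may lie outside \<open>U\<close>.\<close>

lemma borel_measurable_mirror_step:
  assumes \<eta>: "0 < \<eta>" and g: "g \<in> borel_measurable N"
    and y: "\<And>x. x \<in> space N \<Longrightarrow> h differentiable (at (y x) within {0..})"
    and breg: "\<And>\<nu>. 0 \<le> \<nu> \<Longrightarrow> (\<lambda>x. bregman h \<nu> (y x)) \<in> borel_measurable N"
    and z: "\<And>x. x \<in> space N \<Longrightarrow>
      is_arg_min (\<lambda>\<nu>. g x \<bullet> \<nu> + 1 / \<eta> * bregman h \<nu> (y x)) (\<lambda>\<nu>. 0 \<le> \<nu>) (z x)"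
  shows "z \<in> borel_measurable N"
proof -
  obtain Q :: "(real ^ 'm) set" where Q: "countable Q" "Q \<subseteq> {0..}" "{0..} \<subseteq> closure Q"
    using separable by blast
  define F where "F x \<nu> = g x \<bullet> \<nu> + 1 / \<eta> * bregman h \<nu> (y x)" for x \<nu>
  show ?thesis
  proof (rule borel_measurable_minimizer[OF Q(1), of F])
    fix q assume "q \<in> Q"
    then have "0 \<le> q" using Q by auto
    then show "(\<lambda>x. F x q) \<in> borel_measurable N"
      unfolding F_def using g breg by simp
    fix x assume x: "x \<in> space N"
    have "(dist q (z x))\<^sup>2 \<le> (l1_norm (q - z x))\<^sup>2"
      using norm_le_l1_norm[of "q - z x"] by (intro power_mono) (auto simp: dist_norm)
    then have "\<sigma> / (2 * \<eta>) * (dist q (z x))\<^sup>2 \<le> \<sigma> / (2 * \<eta>) * (l1_norm (q - z x))\<^sup>2"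
      using \<sigma>_pos \<eta> by (intro mult_left_mono) auto
    then show "F x (z x) + \<sigma> / (2 * \<eta>) * (dist q (z x))\<^sup>2 \<le> F x q"
      using mirror_step_growth[OF \<eta> y[OF x] z[OF x] \<open>0 \<le> q\<close>] by (simp add: F_def)
  next
    show "0 < \<sigma> / (2 * \<eta>)" using \<sigma>_pos \<eta> by simp
  next
    fix x and e :: real assume x: "x \<in> space N" and e: "0 < e"
    have "continuous (at (z x) within {0..}) (F x)"
      unfolding F_def
      using mirror_objective_has_derivative[OF y[OF x] mirror_step_differentiable[OF \<eta> y[OF x] z[OF x]]]
      by (rule has_derivative_continuous)
    then obtain d where d: "0 < d"
      "\<And>\<nu>. 0 \<le> \<nu> \<Longrightarrow> dist \<nu> (z x) < d \<Longrightarrow> dist (F x \<nu>) (F x (z x)) < e"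
      using e unfolding continuous_within_eps_delta by (metis atLeast_iff)
    have "z x \<in> closure Q" using z[OF x] Q(3) by (auto simp: is_arg_min_def)
    then obtain q where q: "q \<in> Q" "dist q (z x) < d"
      using d(1) unfolding closure_approachable by blast
    then have "dist (F x q) (F x (z x)) < e" using d(2) Q(2) by auto
    then show "\<exists>q\<in>Q. F x q < F x (z x) + e"
      using q(1) by (intro bexI[of _ q]) (auto simp: dist_real_def)
  qed
qed

end

section \<open>Iterates as measurable functions of the request history\<close>

locale allocation_process = mirror_map \<sigma> h U
  for \<sigma> h and U :: "(real ^ 'm::finite) set" +
  fixes M :: "('d::finite, 'm) request measure" and T :: nat and \<rho> \<mu>1 :: "real ^ 'm"
    and fbar bbar \<eta> :: real and xt :: "nat \<Rightarrow> (nat \<Rightarrow> ('d, 'm) request) \<Rightarrow> real ^ 'd"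
    and x :: "(nat \<Rightarrow> ('d, 'm) request) \<Rightarrow> nat \<Rightarrow> real ^ 'd"
    and B mu :: "(nat \<Rightarrow> ('d, 'm) request) \<Rightarrow> nat \<Rightarrow> real ^ 'm"
  assumes T_pos: "1 \<le> T"
    and \<rho>_pos: "\<And>j. 0 < \<rho> $ j"
    and requests: "\<And>g. g \<in> space M \<Longrightarrow> is_request g"
    and bounded: "bounded_requests (space M) fbar bbar"
    and measurable: "measurable_requests M T \<rho>"
    and \<eta>_pos: "0 < \<eta>"
    and \<mu>1: "0 \<le> \<mu>1" "h differentiable (at \<mu>1 within {0..})"
    and rule: "measurable_rule M T xt"
    and descent: "\<And>\<gamma>. \<gamma> \<in> space (hist T M) \<Longrightarrow> dual_mirror_descent T \<rho> h \<eta> \<mu>1 \<gamma>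
      (\<lambda>t. xt t (restrict \<gamma> {1..t})) (x \<gamma>) (B \<gamma>) (mu \<gamma>)"
begin

abbreviation cons where "cons \<gamma> t \<equiv> consumption (\<gamma> t) (xt t (restrict \<gamma> {1..t}))"

lemma hist_component: "\<gamma> \<in> space (hist s M) \<Longrightarrow> t \<in> {1..s} \<Longrightarrow> \<gamma> t \<in> space M"
  by (auto simp: space_PiM PiE_def Pi_def)

lemma descent_run:
  assumes "\<gamma> \<in> space (hist T M)"
  shows "descent_run \<sigma> h U (space M) T \<rho> \<mu>1 fbar bbar \<eta> \<gamma>
    (\<lambda>t. xt t (restrict \<gamma> {1..t})) (x \<gamma>) (B \<gamma>) (mu \<gamma>)"
  by unfold_locales (use \<rho>_pos requests bounded \<eta>_pos \<mu>1 descent assms hist_component in auto)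

lemmas mu_good = descent_run.mu_good[OF descent_run]
lemmas mu_step = descent_run.run_step(4)[OF descent_run]

lemma mu_1: "\<gamma> \<in> space (hist T M) \<Longrightarrow> mu \<gamma> 1 = \<mu>1"
  using descent by (simp add: dual_mirror_descent_def)

lemma mu_in_U:
  assumes "\<gamma> \<in> space (hist T M)" "t \<in> {1..T}"
  shows "mu \<gamma> (t + 1) \<in> U"
  using U_arg_min[OF \<eta>_pos mu_good(2) mu_step] assms by auto

lemma cons_measurable:
  assumes "1 \<le> t" "t \<le> s" "t \<le> T"
  shows "(\<lambda>\<omega>. cons \<omega> t) \<in> borel_measurable (hist s M)"
proof -
  have "(\<lambda>\<omega>. consumption (\<omega> t) (xt t \<omega>)) \<in> borel_measurable (hist t M)"
    using rule assms by (simp add: measurable_rule_def)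
  moreover have "(\<lambda>\<omega>. restrict \<omega> {1..t}) \<in> measurable (hist s M) (hist t M)"
    using assms by (intro measurable_restrict_subset) auto
  ultimately have "(\<lambda>\<omega>. consumption (restrict \<omega> {1..t} t) (xt t (restrict \<omega> {1..t})))
      \<in> borel_measurable (hist s M)"
    by (rule measurable_compose[rotated])
  then show ?thesis using assms by simp
qed

lemma cons_past:
  assumes "1 \<le> r" "r \<le> s"
  shows "cons (restrict \<gamma> {1..s}) r = cons \<gamma> r"
proof -
  have "{1..s} \<inter> {1..r} = {1..r}" using assms by auto
  then show ?thesis using assms by (simp add: restrict_restrict)
qed

lemma mu_measurable:
  assumes "t \<in> {1..T}"
  shows "(\<lambda>\<gamma>. mu \<gamma> t) \<in> borel_measurable (hist T M)"
proof -
  have "(\<lambda>\<gamma>. mu \<gamma> (Suc n)) \<in> borel_measurable (hist T M)" if "Suc n \<le> T" for n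
    using that
  proof (induction n)
    case 0
    have "(\<lambda>\<gamma>. mu \<gamma> (Suc 0)) \<in> borel_measurable (hist T M)
        \<longleftrightarrow> (\<lambda>\<gamma>. \<mu>1) \<in> borel_measurable (hist T M)"
      by (rule measurable_cong) (use mu_1 in simp)
    then show ?case by simp
  next
    case (Suc n)
    then have n: "Suc n \<in> {1..T}" by simp
    \<comment> \<open>After the first step the iterates lie in \<open>U\<close>; before it the base
      point is the constant \<open>\<mu>1\<close>.\<close>
    have breg: "(\<lambda>\<gamma>. bregman h \<nu> (mu \<gamma> (Suc n))) \<in> borel_measurable (hist T M)"
      if "0 \<le> \<nu>" for \<nu>
    proof (cases n)
      case 0
      have "(\<lambda>\<gamma>. bregman h \<nu> (mu \<gamma> (Suc n))) \<in> borel_measurable (hist T M)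
          \<longleftrightarrow> (\<lambda>\<gamma>. bregman h \<nu> \<mu>1) \<in> borel_measurable (hist T M)"
        by (rule measurable_cong) (use mu_1 0 in simp)
      then show ?thesis by simp
    next
      case (Suc n')
      then show ?thesis
        using Suc.IH Suc.prems mu_in_U[of _ n] n by (intro borel_measurable_bregman that) auto
    qed
    have step: "is_arg_min (\<lambda>\<nu>. (\<rho> - cons \<gamma> (Suc n)) \<bullet> \<nu> + 1 / \<eta> * bregman h \<nu> (mu \<gamma> (Suc n)))
        (\<lambda>\<nu>. 0 \<le> \<nu>) (mu \<gamma> (Suc (Suc n)))" if "\<gamma> \<in> space (hist T M)" for \<gamma>
      using mu_step[OF that n] by simp
    show ?case
    proof (rule borel_measurable_mirror_step[OF \<eta>_pos _ _ breg step])
      show "(\<lambda>\<gamma>. \<rho> - cons \<gamma> (Suc n)) \<in> borel_measurable (hist T M)"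
        using cons_measurable[of "Suc n" T] n by simp
      show "h differentiable (at (mu \<gamma> (Suc n)) within {0..})" if "\<gamma> \<in> space (hist T M)" for \<gamma>
        using mu_good(2)[OF that] n by simp
    qed
  qed
  from this[of "t - 1"] assms show ?thesis by simp
qed

text \<open>The iterates are given by a relation along the whole sequence. Uniqueness of the mirror
  step makes the next iterate a function of the present one and of the current consumption, which
  depends on the history only.\<close>

lemma mu_nonanticipating:
  assumes "\<gamma> \<in> space (hist T M)" "\<gamma>' \<in> space (hist T M)"
    and "t \<in> {1..T}" "\<And>s. s \<in> {1..t - 1} \<Longrightarrow> \<gamma> s = \<gamma>' s"
  shows "mu \<gamma> t = mu \<gamma>' t"
proof -
  have "mu \<gamma> (Suc n) = mu \<gamma>' (Suc n)" if "Suc n \<le> t" for n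
    using that
  proof (induction n)
    case 0
    then show ?case using mu_1 assms by simp
  next
    case (Suc n)
    then have n: "Suc n \<in> {1..T}" and IH: "mu \<gamma> (Suc n) = mu \<gamma>' (Suc n)" using assms(3) by auto
    have "restrict \<gamma> {1..Suc n} = restrict \<gamma>' {1..Suc n}" "\<gamma> (Suc n) = \<gamma>' (Suc n)"
      using assms(4) Suc.prems by (auto simp: restrict_def fun_eq_iff)
    then show ?case
      using mirror_step_unique[OF \<eta>_pos mu_good(2)[OF assms(1)] mu_step[OF assms(1) n]]
        mu_step[OF assms(2) n] n IH by simp
  qed
  from this[of "t - 1"] assms(3) show ?thesis by simp
qed

text \<open>A bound uniform over request sequences, as required for dominated convergence in
  \<open>lagged_dual_bound\<close>.\<close>

lemma mu_bounded:
  assumes "\<gamma> \<in> space (hist T M)" "t \<in> {1..T}"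
  shows "norm (mu \<gamma> t) \<le> norm \<mu>1 + real T * (\<eta> * (bbar + Max (range (\<lambda>j. \<rho> $ j))) / \<sigma>)"
proof -
  interpret descent_run \<sigma> h U "space M" T \<rho> \<mu>1 fbar bbar \<eta> \<gamma>
    "\<lambda>t. xt t (restrict \<gamma> {1..t})" "x \<gamma>" "B \<gamma>" "mu \<gamma>"
    by (rule descent_run[OF assms(1)])
  have t: "1 + (t - 1) = t" "1 + (t - 1) \<le> T + 1" using assms(2) by auto
  have "norm (\<mu>1 - mu \<gamma> t) \<le> real (t - 1) * (\<eta> * G / \<sigma>)"
    using mu_movement[of 1 "t - 1"] norm_le_l1_norm[of "\<mu>1 - mu \<gamma> t"] mu_1[OF assms(1)]
    unfolding t(1) using t(2) by force
  also have "\<dots> \<le> real T * (\<eta> * G / \<sigma>)"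
    using assms G_nonneg \<eta>_pos \<sigma>_pos by (intro mult_right_mono) auto
  finally show ?thesis using norm_triangle_ineq4[of \<mu>1 "\<mu>1 - mu \<gamma> t"] by simp
qed

text \<open>Short histories are padded with a fixed request, whose choice does not affect \<open>mu \<gamma> t\<close>.\<close>

lemma mu_past:
  assumes t: "t \<in> {1..T}" and "space M \<noteq> {}"
  obtains m where "m \<in> borel_measurable (hist (t - 1) M)"
    and "\<And>\<omega>. \<omega> \<in> space (hist (t - 1) M) \<Longrightarrow> \<exists>\<gamma>\<in>space (hist T M). m \<omega> = mu \<gamma> t"
    and "\<And>\<gamma>. \<gamma> \<in> space (hist T M) \<Longrightarrow> m (restrict \<gamma> {1..t - 1}) = mu \<gamma> t"
proof -
  obtain g0 where g0: "g0 \<in> space M" using assms(2) by blast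
  define ext where "ext \<omega> = (\<lambda>i\<in>{1..T}. if i \<le> t - 1 then \<omega> i else g0)" for \<omega> :: "nat \<Rightarrow> ('d, 'm) request"
  have ext: "ext \<in> measurable (hist (t - 1) M) (hist T M)"
    unfolding ext_def
  proof (rule measurable_restrict)
    fix i assume "i \<in> {1..T}"
    then show "(\<lambda>\<omega>. if i \<le> t - 1 then \<omega> i else g0) \<in> measurable (hist (t - 1) M) M"
      using g0 by (cases "i \<le> t - 1") (auto intro: measurable_component_singleton)
  qed
  show ?thesis
  proof (rule that[of "\<lambda>\<omega>. mu (ext \<omega>) t"])
    show "(\<lambda>\<omega>. mu (ext \<omega>) t) \<in> borel_measurable (hist (t - 1) M)"
      by (rule measurable_compose[OF ext mu_measurable[OF t]])
    show "\<exists>\<gamma>\<in>space (hist T M). mu (ext \<omega>) t = mu \<gamma> t" if "\<omega> \<in> space (hist (t - 1) M)" for \<omega>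
      using measurable_space[OF ext that] by blast
    fix \<gamma> assume \<gamma>: "\<gamma> \<in> space (hist T M)"
    have "restrict \<gamma> {1..t - 1} \<in> space (hist (t - 1) M)"
      using \<gamma> t by (auto simp: space_PiM PiE_def Pi_def)
    from measurable_space[OF ext this] show "mu (ext (restrict \<gamma> {1..t - 1})) t = mu \<gamma> t"
      by (rule mu_nonanticipating[OF _ \<gamma> t]) (use t in \<open>auto simp: ext_def\<close>)
  qed
qed

end

section \<open>Expected regret\<close>

text \<open>\<open>f\<close> need not be integrable: its integral is then \<open>0\<close> by convention, whence \<open>0 \<le> a\<close>.\<close>

lemma (in prob_space) integral_le_of_integrable_bound:
  fixes f W :: "'a \<Rightarrow> real"
  assumes "integrable M W" "\<And>x. x \<in> space M \<Longrightarrow> f x \<le> W x" "integral\<^sup>L M W \<le> a" "0 \<le> a"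
  shows "integral\<^sup>L M f \<le> a"
proof (cases "integrable M f")
  case True
  then have "integral\<^sup>L M f \<le> integral\<^sup>L M W" using assms by (intro integral_mono)
  then show ?thesis using assms by simp
next
  case False
  then show ?thesis using assms by (simp add: not_integrable_integral_eq)
qed

section \<open>Comparison of rewards and optimum in expectation\<close>

context allocation_process begin

text \<open>The summand of \<open>reward_lower_bound\<close>; for the stationary dual value
  \<open>c\<close> its expectation is at least \<open>- fbar * \<delta>\<close>.\<close>

abbreviation excess :: "real \<Rightarrow> (nat \<Rightarrow> ('d, 'm) request) \<Rightarrow> nat \<Rightarrow> nat \<Rightarrow> real" where
  "excess c \<gamma> k t \<equiv> if unconstrained T \<rho> bbar (cons \<gamma>) t
     then opt_reward (\<gamma> (t + k)) (mu \<gamma> t) + mu \<gamma> t \<bullet> \<rho> - c else 0"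

lemma opt_reward_measurable: "0 \<le> \<mu> \<Longrightarrow> (\<lambda>g. opt_reward g \<mu>) \<in> borel_measurable M"
  using measurable by (simp add: measurable_requests_def)

lemma opt_reward_continuous:
  assumes "g \<in> space M"
  shows "continuous_on {0..} (opt_reward g)"
proof -
  have b: "0 \<le> bbar" by (rule bbar_nonneg[OF bounded requests])
  have le: "opt_reward g \<mu> - opt_reward g \<nu> \<le> bbar * (real CARD('m) * dist \<mu> \<nu>)"
    if "0 \<le> \<mu>" "0 \<le> \<nu>" for \<mu> \<nu>
  proof -
    have "l1_norm (\<mu> - \<nu>) \<le> real CARD('m) * norm (\<mu> - \<nu>)"
      using sum_bounded_above[of UNIV "\<lambda>i. \<bar>(\<mu> - \<nu>) $ i\<bar>" "norm (\<mu> - \<nu>)"]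
        component_le_norm_cart[of "\<mu> - \<nu>"] by (simp add: l1_norm_def)
    then have "bbar * l1_norm (\<mu> - \<nu>) \<le> bbar * (real CARD('m) * dist \<mu> \<nu>)"
      unfolding dist_norm using b by (rule mult_left_mono)
    then show ?thesis using opt_reward_lipschitz[OF bounded requests assms that] by simp
  qed
  have "(bbar * real CARD('m))-lipschitz_on {0..} (opt_reward g)"
  proof (rule lipschitz_onI)
    fix \<mu> \<nu> :: "real ^ 'm" assume "\<mu> \<in> {0..}" "\<nu> \<in> {0..}"
    then show "dist (opt_reward g \<mu>) (opt_reward g \<nu>) \<le> bbar * real CARD('m) * dist \<mu> \<nu>"
      using le[of \<mu> \<nu>] le[of \<nu> \<mu>] by (auto simp: dist_real_def dist_commute abs_le_iff mult.assoc)
  qed (use b in simp)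
  then show ?thesis by (rule lipschitz_on_continuous_on)
qed

text \<open>The stopping rule is predictable, so it can serve as the past event on which the lagged
  request is conditioned.\<close>

lemma unconstrained_past_sets:
  assumes "t \<le> T"
  shows "{\<omega> \<in> space (hist (t - 1) M). unconstrained T \<rho> bbar (cons \<omega>) t} \<in> sets (hist (t - 1) M)"
proof -
  have "{\<omega> \<in> space (hist (t - 1) M). \<forall>j\<in>UNIV. (\<Sum>s=1..t - 1. cons \<omega> s $ j) + bbar \<le> real T * \<rho> $ j}
      \<in> sets (hist (t - 1) M)"
  proof (intro sets.sets_Collect_countable_All')
    fix j
    have "(\<lambda>\<omega>. (\<Sum>s=1..t - 1. cons \<omega> s $ j) + bbar) \<in> borel_measurable (hist (t - 1) M)"
      using cons_measurable[of _ "t - 1"] assms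
      by (intro borel_measurable_add borel_measurable_sum
          borel_measurable_continuous_on[of "\<lambda>v. v $ j"] continuous_intros) auto
    then show "{\<omega> \<in> space (hist (t - 1) M). (\<Sum>s=1..t - 1. cons \<omega> s $ j) + bbar \<le> real T * \<rho> $ j}
        \<in> sets (hist (t - 1) M)"
      by (rule borel_measurable_le) simp
  qed simp
  then show ?thesis by (simp add: unconstrained_def)
qed

lemma unconstrained_past:
  "unconstrained T \<rho> bbar (cons (restrict \<gamma> {1..t - 1})) t \<longleftrightarrow> unconstrained T \<rho> bbar (cons \<gamma>) t"
proof -
  have "(\<Sum>s=1..t - 1. cons (restrict \<gamma> {1..t - 1}) s $ j) = (\<Sum>s=1..t - 1. cons \<gamma> s $ j)" for j
    by (intro sum.cong refl) (use cons_past in auto)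
  then show ?thesis by (simp only: unconstrained_def)
qed

text \<open>The optimum is bounded with an arbitrary multiplier \<open>\<mu>\<close>, the rewards
  with the infimum \<open>c\<close>; passing to the infimum over \<open>\<mu>\<close> only at the
  end spares a proof that it is attained.\<close>

lemma expected_regret:
  assumes P: "prob_space P" "sets P = sets (hist T M)" and k: "k \<le> T" and \<delta>: "0 \<le> \<delta>"
    and cond: "\<And>t. t \<in> {1..T - k} \<Longrightarrow> cond_distribution M P (t + k) (t - 1) (K (t + k) (t - 1))"
    and Q: "prob_space Q" "sets Q = sets M" and tv: "TV_lag M T k K Q \<le> ennreal \<delta>"
  shows "(\<integral>\<gamma>. OPT T \<rho> \<gamma> - (\<Sum>t=1..T. reward (\<gamma> t) (x \<gamma> t)) \<partial>P)
    \<le> fbar * bbar / Min (range (\<lambda>j. \<rho> $ j))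
      + real T * (\<eta> * (bbar + Max (range (\<lambda>j. \<rho> $ j)))\<^sup>2 / (2 * \<sigma>))
      + Max ((\<lambda>\<mu>. bregman h \<mu> \<mu>1) ` ({0} \<union> range (\<lambda>j. (fbar / \<rho> $ j) *\<^sub>R axis j 1))) / \<eta>
      + real T * (bbar * (real k * (\<eta> * (bbar + Max (range (\<lambda>j. \<rho> $ j))) / \<sigma>)))
      + 2 * fbar * real T * \<delta> + 2 * fbar * real k"
    (is "?regret \<le> ?C1 + ?C2 + ?C3 + ?C4 + _ + _")
proof -
  interpret P: prob_space P by (rule P)
  interpret Q: prob_space Q by (rule Q)
  have space_P: "space P = space (hist T M)" using P(2) by (rule sets_eq_imp_space_eq)
  have space_Q: "space Q = space M" using Q(2) by (rule sets_eq_imp_space_eq)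
  have f0: "0 \<le> fbar" and b0: "0 \<le> bbar"
    using fbar_nonneg[OF bounded requests] bbar_nonneg[OF bounded requests] by auto
  have \<rho>0: "0 \<le> \<rho>" using \<rho>_pos by (simp add: less_eq_vec_def less_imp_le)
  note opt_bounds = opt_reward_nonneg[OF bounded requests] opt_reward_le[OF bounded requests]
  have "space M \<noteq> {}" using Q.not_empty space_Q by simp

  have lag: "lagged_process P M T (t - 1) (t + k) (K (t + k) (t - 1)) Q \<delta>"
    if t: "t \<in> {1..T - k}" for t
  proof (intro lagged_process.intro lagged_process_axioms.intro P Q \<delta> cond t)
    show "t - 1 \<le> T" "t + k \<in> {1..T}" using t by auto
    fix \<gamma> assume "\<gamma> \<in> space (hist T M)"
    then have "tv_dist M (K (t + k) (t - 1) (restrict \<gamma> {1..t - 1})) Q \<le> TV_lag M T k K Q"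
      unfolding TV_lag_def using t by (intro SUP_upper2[of \<gamma>] SUP_upper2[of t]) auto
    with tv show "tv_dist M (K (t + k) (t - 1) (restrict \<gamma> {1..t - 1})) Q \<le> ennreal \<delta>" by simp
  qed

  define D where "D \<mu> = integral\<^sup>L Q (\<lambda>g. opt_reward g \<mu>) + \<mu> \<bullet> \<rho>" for \<mu>
  have intQ: "integrable Q (\<lambda>g. opt_reward g \<mu>)" if "0 \<le> \<mu>" for \<mu>
    using opt_bounds that space_Q opt_reward_measurable[OF that]
    by (intro Q.integrable_const_bound[where B=fbar]) (auto simp: measurable_cong_sets[OF Q(2) refl])
  have IQ: "0 \<le> integral\<^sup>L Q (\<lambda>g. opt_reward g \<mu>)" "integral\<^sup>L Q (\<lambda>g. opt_reward g \<mu>) \<le> fbar"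
    if "0 \<le> \<mu>" for \<mu>
    using opt_bounds that space_Q intQ[OF that]
    by (auto intro!: integral_nonneg_AE Q.integral_le_const)
  have D0: "0 \<le> D \<mu>" if "0 \<le> \<mu>" for \<mu>
    using IQ(1)[OF that] inner_nonneg_vec[OF that \<rho>0] by (simp add: D_def)
  \<comment> \<open>Its range \<open>[0, fbar]\<close>, with the upper end from
    \<open>\<mu> = 0\<close>, is what lets each lost period be charged with
    \<open>fbar\<close>.\<close>
  define c where "c = (INF \<mu>\<in>{0..}. D \<mu>)"
  have bdd: "bdd_below (D ` {0..})" using D0 by (intro bdd_belowI[of _ 0]) auto
  have c_le: "c \<le> D \<mu>" if "0 \<le> \<mu>" for \<mu>
    unfolding c_def using bdd that by (intro cINF_lower) auto
  have c0: "0 \<le> c" unfolding c_def using D0 by (intro cINF_greatest) auto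
  have cf: "c \<le> fbar" using c_le[of 0] IQ(2)[of 0] by (simp add: D_def)

  have Z: "integrable P (\<lambda>\<gamma>. excess c \<gamma> k t)" "- fbar * \<delta> \<le> (\<integral>\<gamma>. excess c \<gamma> k t \<partial>P)"
    if t: "t \<in> {1..T - k}" for t
  proof -
    interpret L: lagged_process P M T "t - 1" "t + k" "K (t + k) (t - 1)" Q \<delta> by (rule lag[OF t])
    have tT: "t \<in> {1..T}" using t by auto
    obtain m where m: "m \<in> borel_measurable (hist (t - 1) M)"
      and m_mu: "\<And>\<omega>. \<omega> \<in> space (hist (t - 1) M) \<Longrightarrow> \<exists>\<gamma>\<in>space (hist T M). m \<omega> = mu \<gamma> t"
      and m_eq: "\<And>\<gamma>. \<gamma> \<in> space (hist T M) \<Longrightarrow> m (restrict \<gamma> {1..t - 1}) = mu \<gamma> t"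
      using mu_past[OF tT \<open>space M \<noteq> {}\<close>] by blast
    define A where "A = {\<omega> \<in> space (hist (t - 1) M). unconstrained T \<rho> bbar (cons \<omega>) t}"
    have A: "A \<in> sets (hist (t - 1) M)" unfolding A_def using tT by (intro unconstrained_past_sets) simp
    let ?X = "\<lambda>\<gamma>. indicator A (restrict \<gamma> {1..t - 1}) * (opt_reward (\<gamma> (t + k)) (m (restrict \<gamma> {1..t - 1}))
      + m (restrict \<gamma> {1..t - 1}) \<bullet> \<rho> - c)"
    have mn: "0 \<le> m \<omega>" if "\<omega> \<in> space (hist (t - 1) M)" for \<omega>
      using m_mu[OF that] mu_good(1) tT by force
    have mb: "norm (m \<omega>) \<le> norm \<mu>1 + real T * (\<eta> * (bbar + Max (range (\<lambda>j. \<rho> $ j))) / \<sigma>)"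
      if "\<omega> \<in> space (hist (t - 1) M)" for \<omega>
      using m_mu[OF that] mu_bounded[OF _ tT] by auto
    have X: "integrable P ?X" "- fbar * \<delta> \<le> integral\<^sup>L P ?X"
      using L.lagged_dual_bound[OF A m mn mb opt_reward_measurable opt_bounds f0 opt_reward_continuous,
          of c \<rho>] c_le by (simp_all add: D_def)
    have eq: "excess c \<gamma> k t = ?X \<gamma>" if "\<gamma> \<in> space P" for \<gamma>
      using that m_eq unconstrained_past measurable_space[OF L.measurable_past that] space_P
      by (simp add: A_def indicator_def)
    show "integrable P (\<lambda>\<gamma>. excess c \<gamma> k t)"
      by (subst Bochner_Integration.integrable_cong[OF refl eq]) (use X(1) in auto)
    show "- fbar * \<delta> \<le> (\<integral>\<gamma>. excess c \<gamma> k t \<partial>P)"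
      by (subst Bochner_Integration.integral_cong[OF refl eq]) (use X(2) in auto)
  qed

  have O: "integrable P (\<lambda>\<gamma>. opt_reward (\<gamma> t) \<mu>)"
    "(\<integral>\<gamma>. opt_reward (\<gamma> t) \<mu> \<partial>P) \<le> integral\<^sup>L Q (\<lambda>g. opt_reward g \<mu>) + fbar * \<delta> + (if t \<le> k then fbar else 0)"
    if \<mu>: "0 \<le> \<mu>" and t: "t \<in> {1..T}" for \<mu> t
  proof -
    have comp: "(\<lambda>\<gamma>. \<gamma> t) \<in> measurable P M"
      using t by (simp add: measurable_cong_sets[OF P(2) refl] measurable_component_singleton)
    have bnd: "0 \<le> opt_reward (\<gamma> t) \<mu>" "opt_reward (\<gamma> t) \<mu> \<le> fbar" if "\<gamma> \<in> space P" for \<gamma>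
      using opt_bounds measurable_space[OF comp that] \<mu> by auto
    show int: "integrable P (\<lambda>\<gamma>. opt_reward (\<gamma> t) \<mu>)"
      using bnd measurable_compose[OF comp opt_reward_measurable[OF \<mu>]]
      by (intro P.integrable_const_bound[where B=fbar]) auto
    show "(\<integral>\<gamma>. opt_reward (\<gamma> t) \<mu> \<partial>P)
        \<le> integral\<^sup>L Q (\<lambda>g. opt_reward g \<mu>) + fbar * \<delta> + (if t \<le> k then fbar else 0)"
    proof (cases "t \<le> k")
      \<comment> \<open>The earliest request with a lagged conditional law is that of period
        \<open>k + 1\<close>, so only the trivial bound is left here.\<close>
      case True
      have "(\<integral>\<gamma>. opt_reward (\<gamma> t) \<mu> \<partial>P) \<le> fbar"
        using int bnd by (intro P.integral_le_const) auto
      then show ?thesis using True IQ(1)[OF \<mu>] f0 \<delta> by (simp add: add_increasing)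
    next
      case False
      define s where "s = t - k"
      have s: "s \<in> {1..T - k}" "t = s + k" using False t k by (auto simp: s_def)
      interpret L: lagged_process P M T "s - 1" "s + k" "K (s + k) (s - 1)" Q \<delta> by (rule lag[OF s(1)])
      \<comment> \<open>The full space of histories as past event turns the conditional bound into
        one on the marginal law.\<close>
      let ?A = "space (hist (s - 1) M)"
      have past: "\<gamma> \<in> space P \<Longrightarrow> restrict \<gamma> {1..s - 1} \<in> ?A" for \<gamma>
        by (rule measurable_space[OF L.measurable_past])
      have "(\<integral>\<gamma>. opt_reward (\<gamma> t) \<mu> \<partial>P)
          = (\<integral>\<gamma>. indicator ?A (restrict \<gamma> {1..s - 1}) * opt_reward (\<gamma> (s + k)) \<mu> \<partial>P)"
        using past by (intro Bochner_Integration.integral_cong) (auto simp: s(2))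
      also have "\<dots> \<le> measure P (L.past ?A) * integral\<^sup>L Q (\<lambda>g. opt_reward g \<mu>)
          + fbar * (measure P (L.past ?A) * \<delta>)"
        by (rule L.integral_past_le[OF sets.top opt_reward_measurable[OF \<mu>] _ _ f0])
          (use opt_bounds \<mu> in auto)
      also have "L.past ?A = space P" using past by blast
      finally show ?thesis using False by (simp add: P.prob_space)
    qed
  qed

  define E where "E = ?C1 + ?C2 + ?C3 + ?C4 + fbar * real k"
  have C_nonneg: "0 \<le> ?C1 + ?C2 + ?C3 + ?C4"
  proof -
    obtain \<gamma> where "\<gamma> \<in> space (hist T M)" using P.not_empty unfolding space_P by blast
    then interpret R: descent_run \<sigma> h U "space M" T \<rho> \<mu>1 fbar bbar \<eta> \<gamma>
      "\<lambda>t. xt t (restrict \<gamma> {1..t})" "x \<gamma>" "B \<gamma>" "mu \<gamma>"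
      by (rule descent_run)
    have "0 < Min (range (\<lambda>j. \<rho> $ j))" using \<rho>_pos by (subst Min_gr_iff) auto
    then have "0 \<le> ?C1" using f0 b0 by (intro divide_nonneg_pos mult_nonneg_nonneg)
    moreover have "0 \<le> ?C2" "0 \<le> ?C4" using \<eta>_pos \<sigma>_pos b0 R.G_nonneg by simp_all
    moreover have "0 \<le> bregman h 0 \<mu>1"
    proof -
      have "0 \<le> \<sigma> / 2 * (l1_norm (0 - \<mu>1))\<^sup>2" using \<sigma>_pos by simp
      also have "\<dots> \<le> bregman h 0 \<mu>1" by (rule bregman_ge[OF strongly_convex \<mu>1(2) _ \<mu>1(1)]) simp
      finally show ?thesis .
    qed
    then have "0 \<le> Max ((\<lambda>\<mu>. bregman h \<mu> \<mu>1) ` ({0} \<union> range (\<lambda>j. (fbar / \<rho> $ j) *\<^sub>R axis j 1)))"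
      by (intro Max_ge_iff[THEN iffD2]) auto
    then have "0 \<le> ?C3" using \<eta>_pos by simp
    ultimately show ?thesis by linarith
  qed

  have key: "?regret \<le> real T * (D \<mu> - c) + E + fbar * real T * \<delta> + fbar * real k + fbar * real T * \<delta>"
    if \<mu>: "0 \<le> \<mu>" for \<mu>
  proof -
    \<comment> \<open>An integrable majorant of the regret: weak duality for the optimum minus the
      lower bound on the rewards. The rewards of the accepted decisions need not be integrated on
      their own.\<close>
    define W where "W \<gamma> = (\<Sum>t=1..T. opt_reward (\<gamma> t) \<mu>) + (real T * (\<mu> \<bullet> \<rho>) + E - real T * c)
        - (\<Sum>t=1..T - k. excess c \<gamma> k t)" for \<gamma>
    have sum_int: "integrable P (\<lambda>\<gamma>. \<Sum>t=1..T. opt_reward (\<gamma> t) \<mu>)"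
      "integrable P (\<lambda>\<gamma>. \<Sum>t=1..T - k. excess c \<gamma> k t)"
      by (rule Bochner_Integration.integrable_sum, erule O(1)[OF \<mu>] Z(1))+
    have sum_eq: "(\<integral>\<gamma>. (\<Sum>t=1..T. opt_reward (\<gamma> t) \<mu>) \<partial>P) = (\<Sum>t=1..T. \<integral>\<gamma>. opt_reward (\<gamma> t) \<mu> \<partial>P)"
      "(\<integral>\<gamma>. (\<Sum>t=1..T - k. excess c \<gamma> k t) \<partial>P) = (\<Sum>t=1..T - k. \<integral>\<gamma>. excess c \<gamma> k t \<partial>P)"
      by (rule Bochner_Integration.integral_sum, erule O(1)[OF \<mu>] Z(1))+
    have intW: "integrable P W"
      unfolding W_def using sum_int
      by (intro Bochner_Integration.integrable_diff Bochner_Integration.integrable_add P.integrable_const)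
    have "OPT T \<rho> \<gamma> - (\<Sum>t=1..T. reward (\<gamma> t) (x \<gamma> t)) \<le> W \<gamma>" if "\<gamma> \<in> space P" for \<gamma>
    proof -
      have \<gamma>: "\<gamma> \<in> space (hist T M)" using that space_P by simp
      have "OPT T \<rho> \<gamma> \<le> (\<Sum>t=1..T. opt_reward (\<gamma> t) \<mu>) + real T * (\<mu> \<bullet> \<rho>)"
        using hist_component[OF \<gamma>] by (intro OPT_le[OF bounded requests _ \<rho>0 \<mu>]) auto
      then show ?thesis
        using descent_run.reward_lower_bound[OF descent_run[OF \<gamma>] k c0 cf]
        unfolding W_def E_def by linarith
    qed
    moreover have "integral\<^sup>L P W
        \<le> real T * (D \<mu> - c) + E + fbar * real T * \<delta> + fbar * real k + fbar * real T * \<delta>"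
    proof -
      have "(\<Sum>t=1..T. \<integral>\<gamma>. opt_reward (\<gamma> t) \<mu> \<partial>P)
          \<le> (\<Sum>t=1..T. integral\<^sup>L Q (\<lambda>g. opt_reward g \<mu>) + fbar * \<delta> + (if t \<le> k then fbar else 0))"
        by (intro sum_mono O(2) \<mu>)
      also have "\<dots> = real T * (integral\<^sup>L Q (\<lambda>g. opt_reward g \<mu>) + fbar * \<delta>)
          + (\<Sum>t=1..T. if t \<le> k then fbar else 0)"
        by (simp add: sum.distrib)
      also have "(\<Sum>t=1..T. if t \<le> k then fbar else 0) = (\<Sum>t\<in>{t\<in>{1..T}. t \<le> k}. fbar)"
        by (intro sum.inter_filter[symmetric]) simp
      also have "{t\<in>{1..T}. t \<le> k} = {1..k}" using k by auto
      also have "(\<Sum>t=1..k. fbar) = fbar * real k" by simp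
      finally have "(\<Sum>t=1..T. \<integral>\<gamma>. opt_reward (\<gamma> t) \<mu> \<partial>P)
          \<le> real T * (integral\<^sup>L Q (\<lambda>g. opt_reward g \<mu>) + fbar * \<delta>) + fbar * real k" .
      moreover have "integral\<^sup>L P W = (\<Sum>t=1..T. \<integral>\<gamma>. opt_reward (\<gamma> t) \<mu> \<partial>P)
          + (real T * (\<mu> \<bullet> \<rho>) + E - real T * c) - (\<Sum>t=1..T - k. \<integral>\<gamma>. excess c \<gamma> k t \<partial>P)"
        unfolding W_def sum_eq[symmetric] using sum_int
        by (subst Bochner_Integration.integral_diff) (simp_all del: sum.cl_ivl_Suc add: P.prob_space)
      moreover have "- (fbar * real T * \<delta>) \<le> (\<Sum>t=1..T - k. \<integral>\<gamma>. excess c \<gamma> k t \<partial>P)"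
      proof -
        have "(\<Sum>t=1..T - k. - fbar * \<delta>) \<le> (\<Sum>t=1..T - k. \<integral>\<gamma>. excess c \<gamma> k t \<partial>P)"
          by (intro sum_mono Z(2))
        moreover have "real (T - k) * (fbar * \<delta>) \<le> real T * (fbar * \<delta>)"
          using f0 \<delta> by (intro mult_right_mono) auto
        ultimately show ?thesis by (simp add: mult_ac)
      qed
      moreover have "real T * (D \<mu> - c) + E + fbar * real T * \<delta> + fbar * real k + fbar * real T * \<delta>
          = real T * (integral\<^sup>L Q (\<lambda>g. opt_reward g \<mu>) + fbar * \<delta>) + fbar * real k
            + (real T * (\<mu> \<bullet> \<rho>) + E - real T * c) + fbar * real T * \<delta>"
        unfolding D_def by (simp add: algebra_simps)
      ultimately show ?thesis by linarith
    qed
    moreover have "0 \<le> real T * (D \<mu> - c) + E + fbar * real T * \<delta> + fbar * real k + fbar * real T * \<delta>"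
      using c_le[OF \<mu>] C_nonneg f0 \<delta> unfolding E_def by simp
    ultimately show ?thesis by (rule P.integral_le_of_integrable_bound[OF intW])
  qed
  \<comment> \<open>\<open>key\<close> solved for \<open>D \<mu>\<close>: a lower bound on all dual
    values is at most their infimum \<open>c\<close>, which removes the term
    \<open>D \<mu> - c\<close>.\<close>
  define r where "r = (?regret - (E + fbar * real T * \<delta> + fbar * real k + fbar * real T * \<delta>)) / real T + c"
  have "r \<le> D \<mu>" if "0 \<le> \<mu>" for \<mu>
    using key[OF that] T_pos by (simp add: r_def field_simps)
  then have "r \<le> c" unfolding c_def by (intro cINF_greatest) auto
  then show ?thesis using T_pos by (simp add: r_def E_def field_simps)
qed

end

theorem theorem5:
  fixes M :: "('d::finite, 'm::finite) request measure"
    and T k :: nat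
    and \<rho> \<mu>1 :: "real ^ 'm"
    and fbar bbar \<sigma> \<eta> \<delta> :: real
    and h :: "real ^ 'm \<Rightarrow> real"
    and xt :: "nat \<Rightarrow> (nat \<Rightarrow> ('d, 'm) request) \<Rightarrow> real ^ 'd"
    and x :: "(nat \<Rightarrow> ('d, 'm) request) \<Rightarrow> nat \<Rightarrow> real ^ 'd"
    and B mu :: "(nat \<Rightarrow> ('d, 'm) request) \<Rightarrow> nat \<Rightarrow> real ^ 'm"
  assumes "T \<ge> 1"
    and "\<forall>j. \<rho> $ j > 0"
    and "\<forall>g\<in>space M. is_request g"
    and "bounded_requests (space M) fbar bbar"
    and "reference_function \<sigma> h"
    and "measurable_requests M T \<rho>"
    and "\<eta> \<ge> 0" and "\<delta> \<ge> 0"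
    and "\<mu>1 \<ge> 0" and "h differentiable (at \<mu>1 within {0..})"
    and "measurable_rule M T xt"
    and "\<forall>\<gamma>\<in>space (hist T M).
           dual_mirror_descent T \<rho> h \<eta> \<mu>1 \<gamma>
             (\<lambda>t. xt t (restrict \<gamma> {1..t})) (x \<gamma>) (B \<gamma>) (mu \<gamma>)"
  shows "let \<rho>min = Min (range (\<lambda>j. \<rho> $ j));
             \<rho>max = Max (range (\<lambda>j. \<rho> $ j));
             C1 = fbar * bbar / \<rho>min;
             C2 = (bbar + \<rho>max)\<^sup>2 / (2 * \<sigma>);
             C3 = Max ((\<lambda>\<mu>. bregman h \<mu> \<mu>1) `
                    ({0} \<union> range (\<lambda>j. (fbar / \<rho> $ j) *\<^sub>R axis j 1)));
             C4 = sqrt 2 * bbar / \<sigma> * (bbar + \<rho>max)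
         in (SUP P\<in>ergodic_class M T \<delta> k.
               ereal (\<integral>\<gamma>. OPT T \<rho> \<gamma> - (\<Sum>t=1..T. reward (\<gamma> t) (x \<gamma> t)) \<partial>P))
            \<le> ereal C1 + ereal (C2 * \<eta> * T) + ereal C3 / ereal \<eta> + ereal (C4 * \<eta> * T * k)
               + ereal (2 * fbar * T * \<delta>) + ereal (2 * fbar * k)"
  unfolding Let_def
proof (rule SUP_least)
  fix P assume "P \<in> ergodic_class M T \<delta> k"
  then obtain K Q where P: "prob_space P" "sets P = sets (hist T M)"
    and cond: "\<forall>t\<in>{1..T - k}. cond_distribution M P (t + k) (t - 1) (K (t + k) (t - 1))"
    and Q: "prob_space Q" "sets Q = sets M" and tv: "TV_lag M T k K Q \<le> ennreal \<delta>"
    unfolding ergodic_class_def space_prob_algebra by blast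
  interpret P: prob_space P by (rule P)
  have space_P: "space P = space (hist T M)" using P(2) by (rule sets_eq_imp_space_eq)
  let ?\<rho>min = "Min (range (\<lambda>j. \<rho> $ j))" and ?\<rho>max = "Max (range (\<lambda>j. \<rho> $ j))"
  let ?W = "{0} \<union> range (\<lambda>j. (fbar / \<rho> $ j) *\<^sub>R axis j 1) :: (real ^ 'm) set"
  let ?C3 = "Max ((\<lambda>\<mu>. bregman h \<mu> \<mu>1) ` ?W)"
  let ?regret = "\<integral>\<gamma>. OPT T \<rho> \<gamma> - (\<Sum>t=1..T. reward (\<gamma> t) (x \<gamma> t)) \<partial>P"
  have bounded: "bounded_requests (space M) fbar bbar"
    and requests: "\<And>g. g \<in> space M \<Longrightarrow> is_request g"
    and descent: "\<And>\<gamma>. \<gamma> \<in> space (hist T M) \<Longrightarrow> dual_mirror_descent T \<rho> h \<eta> \<mu>1 \<gamma>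
             (\<lambda>t. xt t (restrict \<gamma> {1..t})) (x \<gamma>) (B \<gamma>) (mu \<gamma>)"
    using assms by auto
  have f0: "0 \<le> fbar" and b0: "0 \<le> bbar"
    using fbar_nonneg[OF bounded requests] bbar_nonneg[OF bounded requests] by auto
  have \<rho>0: "0 \<le> \<rho>" using assms(2) by (simp add: less_eq_vec_def less_imp_le)
  have \<rho>min: "0 < ?\<rho>min" using assms(2) by (subst Min_gr_iff) auto
  have \<rho>max: "0 < ?\<rho>max" using assms(2) by (subst Max_gr_iff) auto
  have \<sigma>: "0 < \<sigma>" and sc: "strongly_convex_l1_on {0..} \<sigma> h"
    using assms(5) by (auto simp: reference_function_def)
  have C1: "0 \<le> fbar * bbar / ?\<rho>min"
    using f0 b0 \<rho>min by (intro divide_nonneg_pos mult_nonneg_nonneg)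
  have breg: "\<sigma> / 2 * (l1_norm (\<nu> - \<mu>1))\<^sup>2 \<le> ?C3" if "\<nu> \<in> ?W" for \<nu>
  proof -
    have "0 \<le> \<nu>"
      using that f0 assms(2) by (auto simp: less_eq_vec_def axis_def less_imp_le)
    then have "\<sigma> / 2 * (l1_norm (\<nu> - \<mu>1))\<^sup>2 \<le> bregman h \<nu> \<mu>1"
      by (intro bregman_ge[OF sc assms(10) _ assms(9)])
    also have "\<dots> \<le> ?C3" using that by (intro Max_ge) auto
    finally show ?thesis .
  qed
  have C3: "0 \<le> ?C3"
  proof -
    have "0 \<le> \<sigma> / 2 * (l1_norm (0 - \<mu>1))\<^sup>2" using \<sigma> by simp
    also have "\<dots> \<le> ?C3" by (intro breg) simp
    finally show ?thesis .
  qed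
  \<comment> \<open>For \<open>\<eta> = 0\<close> and for \<open>k > T\<close>, where
    \<open>expected_regret\<close> does not apply.\<close>
  have trivial: "?regret \<le> real T * fbar"
  proof (rule P.integral_le_of_integrable_bound[where W="\<lambda>_. real T * fbar"])
    fix \<gamma> assume "\<gamma> \<in> space P"
    then have \<gamma>: "\<gamma> \<in> space (hist T M)" using space_P by simp
    then have *: "\<gamma> t \<in> space M" if "t \<in> {1..T}" for t
      using that by (auto simp: space_PiM PiE_def Pi_def)
    show "OPT T \<rho> \<gamma> - (\<Sum>t=1..T. reward (\<gamma> t) (x \<gamma> t)) \<le> real T * fbar"
      using OPT_le_fbar[OF bounded requests * \<rho>0] rewards_nonneg[OF bounded requests descent[OF \<gamma>] *]
      by force
  qed (use f0 in \<open>auto simp: P.prob_space\<close>)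
  show "ereal ?regret
      \<le> ereal (fbar * bbar / ?\<rho>min) + ereal ((bbar + ?\<rho>max)\<^sup>2 / (2 * \<sigma>) * \<eta> * real T)
        + ereal ?C3 / ereal \<eta> + ereal (sqrt 2 * bbar / \<sigma> * (bbar + ?\<rho>max) * \<eta> * real T * real k)
        + ereal (2 * fbar * real T * \<delta>) + ereal (2 * fbar * real k)"
  proof (cases "\<eta> = 0")
    case True
    show ?thesis
    proof (cases "?C3 = 0")
      case False
      with C3 have "0 < ?C3" by linarith
      moreover have "ereal a / ereal 0 = \<infinity>" if "0 < a" for a using that by simp
      ultimately have "ereal ?C3 / ereal \<eta> = \<infinity>" unfolding True by blast
      then show ?thesis by (simp only: ereal_plus_eq_PInfty plus_ereal.simps ereal_less_eq)
    next
      \<comment> \<open>In \<open>ereal\<close>, \<open>0 / 0 = 0\<close>, so the right-hand side is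
        finite. All comparators then coincide with \<open>\<mu>1\<close>, which forces
        \<open>fbar = 0\<close>, and the crude bound is \<open>0\<close>.\<close>
      case C3_0: True
      have zero: "\<nu> = \<mu>1" if "\<nu> \<in> ?W" for \<nu>
      proof -
        have "(l1_norm (\<nu> - \<mu>1))\<^sup>2 \<le> 0"
          using breg[OF that] \<sigma> unfolding C3_0 by (simp add: mult_le_0_iff)
        then have "norm (\<nu> - \<mu>1) \<le> 0" using norm_le_l1_norm[of "\<nu> - \<mu>1"] by simp
        then show ?thesis by simp
      qed
      fix j
      have "(fbar / \<rho> $ j) *\<^sub>R axis j 1 = (0 :: real ^ 'm)"
        by (rule trans[OF zero zero[symmetric]]) auto
      then have "fbar = 0" using assms(2)[rule_format, of j] by (simp add: axis_eq_0_iff)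
      then show ?thesis using trivial True C3_0 by simp
    qed
  next
    case False
    then have \<eta>: "0 < \<eta>" using assms(7) by simp
    let ?C = "fbar * bbar / ?\<rho>min + (bbar + ?\<rho>max)\<^sup>2 / (2 * \<sigma>) * \<eta> * real T + ?C3 / \<eta>
        + sqrt 2 * bbar / \<sigma> * (bbar + ?\<rho>max) * \<eta> * real T * real k
        + 2 * fbar * real T * \<delta> + 2 * fbar * real k"
    have "?regret \<le> ?C"
    proof (cases "k \<le> T")
      case True
      obtain U where "mirror_map \<sigma> h U" using reference_function_mirror_map[OF assms(5)] by blast
      then interpret mirror_map \<sigma> h U .
      interpret allocation_process \<sigma> h U M T \<rho> \<mu>1 fbar bbar \<eta> xt x B mu
        by unfold_locales (use assms \<eta> in auto)
      \<comment> \<open>The drift estimate yields the term with factor \<open>1\<close>;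
        \<open>sqrt 2\<close> only enlarges it.\<close>
      have "0 \<le> bbar * (\<eta> * (bbar + ?\<rho>max) / \<sigma>) * (real T * real k)"
        using b0 \<rho>max \<sigma> \<eta> by simp
      then have "1 * (bbar * (\<eta> * (bbar + ?\<rho>max) / \<sigma>) * (real T * real k))
          \<le> sqrt 2 * (bbar * (\<eta> * (bbar + ?\<rho>max) / \<sigma>) * (real T * real k))"
        by (intro mult_right_mono) auto
      then show ?thesis
        using expected_regret[OF P True assms(8) cond[rule_format] Q tv] by (simp add: mult_ac)
    next
      case False
      \<comment> \<open>For \<open>k > T\<close> the supremum in \<open>TV_lag\<close> is empty and
        carries no information, but the term \<open>2 * fbar * k\<close> exceeds all attainable
        reward.\<close>
      have "real T * fbar \<le> real k * fbar" using False f0 by (intro mult_right_mono) auto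
      moreover have "0 \<le> sqrt 2 * bbar / \<sigma> * (bbar + ?\<rho>max) * \<eta> * real T * real k"
        by (intro mult_nonneg_nonneg divide_nonneg_nonneg add_nonneg_nonneg) (use b0 \<rho>max \<sigma> \<eta> in auto)
      moreover have "0 \<le> (bbar + ?\<rho>max)\<^sup>2 / (2 * \<sigma>) * \<eta> * real T" "0 \<le> ?C3 / \<eta>"
        "0 \<le> fbar * real T * \<delta>" "0 \<le> fbar * real k"
        using \<sigma> \<eta> C3 f0 assms(8) by auto
      ultimately show ?thesis using trivial C1 by (simp add: mult_ac)
    qed
    moreover have "ereal a / ereal \<eta> = ereal (a / \<eta>)" for a using \<eta> by simp
    ultimately show ?thesis by (simp only: plus_ereal.simps ereal_less_eq)
  qed
qed

end
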